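(* Let $H_1,H_2$ be Hilbert spaces, $A_j\in\mathcal{B}(H_j)$ positive for $j=1,2$, and $X\in\mathcal{B}(H_2,H_1)$, and suppose $T=\begin{bmatrix}A_1 & X\\ X^* & A_2\end{bmatrix}$ is a positive operator on $H_1\oplus H_2$. If $T\in\mathcal{AN}(H_1\oplus H_2)$, then $A_j\in\mathcal{AN}(H_j)$ for $j=1,2$, $\sigma_{ess}(A_1)=\sigma_{ess}(A_2)$, and $X$ is compact.
   Context: Throughout, Hilbert spaces are complex, separable and infinite dimensional; $\mathcal{B}(H_1,H_2)$ denotes bounded linear operators. An operator $S\in\mathcal{B}(H_1,H_2)$ is norm attaining if there is a unit vector $x\in H_1$ with $\|Sx\|=\|S\|$; $S$ is absolutely norm attaining, written $S\in\mathcal{AN}(H_1,H_2)$ (and $\mathcal{AN}(H)=\mathcal{AN}(H,H)$), if for every nonzero closed subspace $M\subseteq H_1$ the restriction $S|_M$ is norm attaining. $\sigma_{ess}(R)$ for $R\in\mathcal{B}(H)$ is the set of $\lambda\in\mathbb{C}$ with $R-\lambda I$ not Fredholm. *)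

theory Defs
  imports "HOL-Analysis.Analysis"
begin

text \<open>A complex inner product space: a real normed vector space with a compatible
complex scalar multiplication and a complex inner product (conjugate-linear in the
first argument, linear in the second) inducing the norm.  A Hilbert space is such a
space which is moreover complete (class complete_space).\<close>

class complex_inner = real_normed_vector +
  fixes scaleC :: "complex \<Rightarrow> 'a \<Rightarrow> 'a" (infixr \<open>*\<^sub>C\<close> 75)
    and cinner :: "'a \<Rightarrow> 'a \<Rightarrow> complex"
  assumes scaleC_add_right: "scaleC a (x + y) = scaleC a x + scaleC a y"
    and scaleC_add_left: "scaleC (a + b) x = scaleC a x + scaleC b x"
    and scaleC_scaleC: "scaleC a (scaleC b x) = scaleC (a * b) x"
    and scaleC_one: "scaleC 1 x = x"
    and scaleR_scaleC: "scaleR r x = scaleC (complex_of_real r) x"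
    and cinner_add_right: "cinner x (y + z) = cinner x y + cinner x z"
    and cinner_scaleC_right: "cinner x (scaleC a y) = a * cinner x y"
    and cinner_commute: "cinner y x = cnj (cinner x y)"
    and cinner_eq_zero_iff: "cinner x x = 0 \<longleftrightarrow> x = 0"
    and norm_eq_sqrt_cinner: "norm x = sqrt (Re (cinner x x))"

text \<open>The orthogonal direct sum H1 \<oplus> H2 is modelled by the product type,
whose norm (from HOL-Analysis) is already sqrt of the sum of squared norms.\<close>

instantiation prod :: (complex_inner, complex_inner) complex_inner
begin

definition scaleC_prod_def: "scaleC c x = (scaleC c (fst x), scaleC c (snd x))"
definition cinner_prod_def: "cinner x y = cinner (fst x) (fst y) + cinner (snd x) (snd y)"

instance
proof
  fix a b :: complex and x y z :: "'a \<times> 'b" and r :: real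
  show "a *\<^sub>C (x + y) = a *\<^sub>C x + a *\<^sub>C y"
    by (simp add: scaleC_prod_def scaleC_add_right)
  show "(a + b) *\<^sub>C x = a *\<^sub>C x + b *\<^sub>C x"
    by (simp add: scaleC_prod_def scaleC_add_left)
  show "a *\<^sub>C b *\<^sub>C x = (a * b) *\<^sub>C x"
    by (simp add: scaleC_prod_def scaleC_scaleC)
  show "1 *\<^sub>C x = x"
    by (simp add: scaleC_prod_def scaleC_one)
  show "r *\<^sub>R x = complex_of_real r *\<^sub>C x"
    by (simp add: scaleC_prod_def scaleR_prod_def scaleR_scaleC)
  show "cinner x (y + z) = cinner x y + cinner x z"
    by (simp add: cinner_prod_def cinner_add_right)
  show "cinner x (a *\<^sub>C y) = a * cinner x y"
    by (simp add: cinner_prod_def scaleC_prod_def cinner_scaleC_right algebra_simps)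
  show "cinner y x = cnj (cinner x y)"
    by (metis cinner_prod_def cinner_commute complex_cnj_add)
  have sq: "Re (cinner z z) = (norm z)\<^sup>2" for z :: "'c::complex_inner"
  proof -
    have "0 \<le> sqrt (Re (cinner z z))" using norm_eq_sqrt_cinner[of z] norm_ge_zero[of z] by simp
    then have "0 \<le> Re (cinner z z)" by simp
    then show ?thesis by (simp add: norm_eq_sqrt_cinner)
  qed
  have n1: "Re (cinner (fst x) (fst x)) = (norm (fst x))\<^sup>2" by (rule sq)
  have n2: "Re (cinner (snd x) (snd x)) = (norm (snd x))\<^sup>2" by (rule sq)
  show "norm x = sqrt (Re (cinner x x))"
    by (simp add: norm_prod_def cinner_prod_def n1 n2)
  show "cinner x x = 0 \<longleftrightarrow> x = 0"
  proof
    assume "cinner x x = 0"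
    then have "Re (cinner x x) = 0" by simp
    then have "(norm (fst x))\<^sup>2 + (norm (snd x))\<^sup>2 = 0"
      by (simp add: cinner_prod_def n1 n2)
    then show "x = 0"
      by (simp add: add_nonneg_eq_0_iff prod_eq_iff)
  next
    have za: "cinner (0::'a) 0 = 0"
      by (simp add: complex_inner_class.cinner_eq_zero_iff)
    have zb: "cinner (0::'b) 0 = 0"
      by (simp add: complex_inner_class.cinner_eq_zero_iff)
    assume "x = 0"
    then show "cinner x x = 0" by (simp add: cinner_prod_def za zb)
  qed
qed

end

definition bounded_clinear :: "('a::complex_inner \<Rightarrow> 'b::complex_inner) \<Rightarrow> bool" where
  "bounded_clinear f \<longleftrightarrow>
     (\<forall>x y. f (x + y) = f x + f y) \<and> (\<forall>c x. f (c *\<^sub>C x) = c *\<^sub>C f x) \<and>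
     (\<exists>K. \<forall>x. norm (f x) \<le> norm x * K)"

definition csubspace :: "'a::complex_inner set \<Rightarrow> bool" where
  "csubspace M \<longleftrightarrow> 0 \<in> M \<and> (\<forall>x\<in>M. \<forall>y\<in>M. x + y \<in> M) \<and> (\<forall>c. \<forall>x\<in>M. c *\<^sub>C x \<in> M)"

definition cspan :: "'a::complex_inner set \<Rightarrow> 'a set" where
  "cspan B = {\<Sum>b\<in>F. c b *\<^sub>C b | F c. finite F \<and> F \<subseteq> B}"

definition finite_dim_set :: "'a::complex_inner set \<Rightarrow> bool" where
  "finite_dim_set S \<longleftrightarrow> (\<exists>B. finite B \<and> S \<subseteq> cspan B)"

definition separable_infdim :: "'a::complex_inner itself \<Rightarrow> bool" where
  "separable_infdim _ \<longleftrightarrow>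
     (\<exists>D::'a set. countable D \<and> closure D = UNIV) \<and> \<not> finite_dim_set (UNIV :: 'a set)"

definition norm_attaining_on :: "'a::complex_inner set \<Rightarrow> ('a \<Rightarrow> 'b::complex_inner) \<Rightarrow> bool" where
  "norm_attaining_on M S \<longleftrightarrow>
     (\<exists>x\<in>M. norm x = 1 \<and> norm (S x) = (SUP y\<in>{y\<in>M. norm y = 1}. norm (S y)))"

definition norm_attaining :: "('a::complex_inner \<Rightarrow> 'b::complex_inner) \<Rightarrow> bool" where
  "norm_attaining S \<longleftrightarrow> norm_attaining_on UNIV S"

definition AN :: "('a::complex_inner \<Rightarrow> 'b::complex_inner) \<Rightarrow> bool" where
  "AN S \<longleftrightarrow> bounded_clinear S \<and>
     (\<forall>M. csubspace M \<and> closed M \<and> M \<noteq> {0} \<longrightarrow> norm_attaining_on M S)"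

definition is_adjoint :: "('a::complex_inner \<Rightarrow> 'b::complex_inner) \<Rightarrow> ('b \<Rightarrow> 'a) \<Rightarrow> bool" where
  "is_adjoint X Y \<longleftrightarrow> (\<forall>x y. cinner (X x) y = cinner x (Y y))"

definition positive_op :: "('a::complex_inner \<Rightarrow> 'a) \<Rightarrow> bool" where
  "positive_op A \<longleftrightarrow> bounded_clinear A \<and>
     (\<forall>x. Im (cinner x (A x)) = 0 \<and> Re (cinner x (A x)) \<ge> 0)"

definition compact_op :: "('a::complex_inner \<Rightarrow> 'b::complex_inner) \<Rightarrow> bool" where
  "compact_op X \<longleftrightarrow> bounded_clinear X \<and> compact (closure (X ` cball 0 1))"

definition fredholm :: "('a::complex_inner \<Rightarrow> 'b::complex_inner) \<Rightarrow> bool" where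
  "fredholm R \<longleftrightarrow> bounded_clinear R \<and> finite_dim_set {x. R x = 0} \<and> closed (range R) \<and>
     (\<exists>B. finite B \<and> (\<forall>y. \<exists>x. y - R x \<in> cspan B))"

definition ess_spectrum :: "('a::complex_inner \<Rightarrow> 'a) \<Rightarrow> complex set" where
  "ess_spectrum R = {l. \<not> fredholm (\<lambda>x. R x - l *\<^sub>C x)}"

definition block_op :: "('a::complex_inner \<Rightarrow> 'a) \<Rightarrow> ('b::complex_inner \<Rightarrow> 'a) \<Rightarrow>
    ('a \<Rightarrow> 'b) \<Rightarrow> ('b \<Rightarrow> 'b) \<Rightarrow> 'a \<times> 'b \<Rightarrow> 'a \<times> 'b" where
  "block_op A1 X Xs A2 = (\<lambda>(x1, x2). (A1 x1 + X x2, Xs x1 + A2 x2))"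

end

theory Submission
  imports Defs
begin

text \<open>A positive operator \<open>T\<close> that is absolutely norm attaining has the form \<open>\<alpha> + R\<close> with \<open>\<alpha> \<ge> 0\<close> and
  \<open>R\<close> compact and nonnegative on a subspace of finite codimension. To see this, let \<open>\<beta>\<close> be the infimum of
  the upper bounds of the form \<open>|T x|\<^sup>2\<close> on the unit spheres of subspaces of finite codimension. If the form were
  not at least \<open>\<beta>\<close> on some such subspace, one could choose inductively an orthonormal sequence, also
  orthogonal for the form, on which the form increases strictly; \<open>T\<close> would not attain its norm on
  the closed span of that sequence. Hence \<open>T\<^sup>2 - \<beta>\<close> is compact with finitely many negative directions, and
  with \<open>\<alpha> = sqrt \<beta>\<close> the same follows for \<open>R = T - \<alpha>\<close>, since \<open>T\<^sup>2 - \<beta> = (T + \<alpha>) (T - \<alpha>)\<close>.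

  These two properties of \<open>R\<close> are inherited by the diagonal compressions \<open>A1 - \<alpha>\<close> and \<open>A2 - \<alpha>\<close>, and \<open>X\<close> is
  compact as an off-diagonal corner of \<open>R\<close>. Conversely they imply that \<open>A1\<close> and \<open>A2\<close> are absolutely norm attaining,
  and compactness alone makes both essential spectra equal to \<open>{\<alpha>}\<close>.\<close>

section \<open>Complex inner product spaces\<close>

lemma cinner_add_left: "cinner (x + y) z = cinner x z + cinner y z"
  by (metis cinner_add_right cinner_commute complex_cnj_add)

lemma cinner_scaleC_left: "cinner (a *\<^sub>C x) y = cnj a * cinner x y"
  by (metis cinner_scaleC_right cinner_commute complex_cnj_mult)

lemma cinner_same: "cinner x x = complex_of_real ((norm x)\<^sup>2)"
proof -
  have "0 \<le> sqrt (Re (cinner x x))"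
    using norm_eq_sqrt_cinner[of x] norm_ge_zero[of x] by simp
  then have "Re (cinner x x) = (norm x)\<^sup>2"
    by (simp add: norm_eq_sqrt_cinner)
  moreover have "Im (cinner x x) = 0"
    using cinner_commute[of x x] by (simp add: complex_eq_iff)
  ultimately show ?thesis
    by (simp add: complex_eq_iff)
qed

lemma scaleC_zero_left [simp]: "0 *\<^sub>C x = 0"
  by (metis of_real_0 scaleR_scaleC scaleR_zero_left)

lemma norm_scaleC: "norm (a *\<^sub>C x) = cmod a * norm x"
proof -
  have "cinner (a *\<^sub>C x) (a *\<^sub>C x) = (a * cnj a) * cinner x x"
    by (simp add: cinner_scaleC_left cinner_scaleC_right)
  then have "complex_of_real ((norm (a *\<^sub>C x))\<^sup>2) = complex_of_real ((cmod a * norm x)\<^sup>2)"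
    by (simp only: cinner_same complex_norm_square[symmetric] of_real_mult[symmetric] power_mult_distrib)
  then have "(norm (a *\<^sub>C x))\<^sup>2 = (cmod a * norm x)\<^sup>2"
    using of_real_eq_iff by blast
  then show ?thesis
    by (simp add: power2_eq_iff_nonneg)
qed

lemma cinner_minus_right: "cinner x (- y) = - cinner x y"
  using cinner_scaleC_right[of x "-1" y] scaleR_scaleC[of "-1" y] by simp

lemma cinner_diff_right: "cinner x (y - z) = cinner x y - cinner x z"
  using cinner_add_right[of x y "- z"] by (simp add: cinner_minus_right)

text \<open>Cauchy-Schwarz: subtracting from \<open>y\<close> its component
  \<open>s *\<^sub>C x\<close> leaves a vector \<open>w\<close> orthogonal to \<open>x\<close>, and
  Pythagoras shows that the component is no longer than \<open>y\<close>.\<close>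

lemma norm_cinner_le: "cmod (cinner x y) \<le> norm x * norm y"
proof (cases "x = 0")
  case True
  then have "cinner x y = 0"
    using cinner_scaleC_left[of 0 x y] by simp
  then show ?thesis by simp
next
  case False
  define s where "s = cinner x y / cinner x x"
  define w where "w = y - s *\<^sub>C x"
  have xx: "cinner x x \<noteq> 0"
    using False by (simp add: cinner_eq_zero_iff)
  have "cinner x w = 0"
    using xx by (simp add: w_def s_def cinner_diff_right cinner_scaleC_right)
  then have wx: "cinner w x = 0"
    using cinner_commute[of w x] by simp
  have y: "y = w + s *\<^sub>C x"
    by (simp add: w_def)
  have "cinner y y = cinner w w + cinner (s *\<^sub>C x) (s *\<^sub>C x)"
    by (subst (1 2) y) (simp add: cinner_add_left cinner_add_right cinner_scaleC_left
        cinner_scaleC_right wx \<open>cinner x w = 0\<close>)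
  then have "complex_of_real ((norm y)\<^sup>2) = complex_of_real ((norm w)\<^sup>2 + (norm (s *\<^sub>C x))\<^sup>2)"
    by (simp add: cinner_same)
  then have "(norm y)\<^sup>2 = (norm w)\<^sup>2 + (norm (s *\<^sub>C x))\<^sup>2"
    using of_real_eq_iff by blast
  then have "(norm (s *\<^sub>C x))\<^sup>2 \<le> (norm y)\<^sup>2"
    by simp
  then have "cmod s * norm x \<le> norm y"
    by (metis abs_le_square_iff abs_norm_cancel norm_scaleC)
  moreover have "cmod s = cmod (cinner x y) / (norm x)\<^sup>2"
    by (simp add: s_def norm_divide cinner_same norm_power)
  ultimately have "cmod (cinner x y) / norm x \<le> norm y"
    using False by (simp add: power2_eq_square)
  then show ?thesis
    using False by (simp add: field_simps)
qed

interpretation cinner: bounded_bilinear cinner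
proof
  show "cinner (r *\<^sub>R x) y = r *\<^sub>R cinner x y" for r :: real and x y :: 'a
    by (simp add: scaleR_scaleC cinner_scaleC_left scaleR_conv_of_real)
  show "cinner x (r *\<^sub>R y) = r *\<^sub>R cinner x y" for r :: real and x y :: 'a
    by (simp add: scaleR_scaleC cinner_scaleC_right scaleR_conv_of_real)
  show "\<exists>K. \<forall>x y :: 'a. norm (cinner x y) \<le> norm x * norm y * K"
    using norm_cinner_le by (metis mult.right_neutral)
qed (simp_all add: cinner_add_left cinner_add_right)

interpretation scaleC: bounded_bilinear scaleC
proof
  show "(r *\<^sub>R a) *\<^sub>C x = r *\<^sub>R (a *\<^sub>C x)" for r :: real and a :: complex and x :: 'a
    by (simp add: scaleR_scaleC scaleC_scaleC scaleR_conv_of_real)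
  show "a *\<^sub>C (r *\<^sub>R x) = r *\<^sub>R (a *\<^sub>C x)" for r :: real and a :: complex and x :: 'a
    by (simp add: scaleR_scaleC scaleC_scaleC mult.commute)
  show "\<exists>K. \<forall>a (x :: 'a). norm (a *\<^sub>C x) \<le> norm a * norm x * K"
    using norm_scaleC by (metis mult.right_neutral order_refl)
qed (simp_all add: scaleC_add_left scaleC_add_right)

lemma Re_cinner_same: "Re (cinner x x) = (norm x)\<^sup>2"
  by (simp add: cinner_same)

lemma cinner_zero_commute: "cinner x y = 0 \<longleftrightarrow> cinner y x = 0"
  by (metis cinner_commute complex_cnj_zero)

lemma Re_cinner_commute: "Re (cinner x y) = Re (cinner y x)"
  using cinner_commute[of x y] by simp

lemma Re_cinner_le: "Re (cinner x y) \<le> norm x * norm y"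
  using norm_cinner_le[of x y] complex_Re_le_cmod[of "cinner x y"] by linarith

lemma norm_add_sq: "(norm (x + y))\<^sup>2 = (norm x)\<^sup>2 + 2 * Re (cinner x y) + (norm y)\<^sup>2"
  for x y :: "'a::complex_inner"
  by (simp add: Re_cinner_same[symmetric] cinner_add_left cinner_add_right Re_cinner_commute[of y x])

lemma norm_add_sq_orthogonal:
  "cinner x y = 0 \<Longrightarrow> (norm (x + y))\<^sup>2 = (norm x)\<^sup>2 + (norm y)\<^sup>2"
  by (simp add: norm_add_sq)

lemma norm_sum_sq_orthogonal:
  assumes "finite F" "\<And>b c. b \<in> F \<Longrightarrow> c \<in> F \<Longrightarrow> b \<noteq> c \<Longrightarrow> cinner (f b) (f c) = 0"
  shows "(norm (\<Sum>b\<in>F. f b))\<^sup>2 = (\<Sum>b\<in>F. (norm (f b))\<^sup>2)"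
  using assms
proof (induction F rule: finite_induct)
  case (insert a F)
  have "cinner (f a) (\<Sum>b\<in>F. f b) = 0"
    using insert.hyps insert.prems by (auto simp: cinner.sum_right intro!: sum.neutral)
  with insert show ?case
    by (simp add: norm_add_sq_orthogonal)
qed simp

section \<open>Bounded complex linear maps\<close>

lemma bounded_clinear_add: "bounded_clinear f \<Longrightarrow> f (x + y) = f x + f y"
  and bounded_clinear_scaleC: "bounded_clinear f \<Longrightarrow> f (c *\<^sub>C x) = c *\<^sub>C f x"
  by (simp_all add: bounded_clinear_def)

lemma bounded_clinear_bounded_linear:
  assumes "bounded_clinear f"
  shows "bounded_linear f"
proof -
  obtain K where "\<forall>x. norm (f x) \<le> norm x * K"
    using assms by (auto simp: bounded_clinear_def)
  with assms show ?thesis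
    by (intro bounded_linear_intro[where K = K]) (auto simp: bounded_clinear_def scaleR_scaleC)
qed

lemma bounded_clinearI:
  assumes "bounded_linear f" "\<And>c x. f (c *\<^sub>C x) = c *\<^sub>C f x"
  shows "bounded_clinear f"
  using assms linear_add[OF bounded_linear.linear, OF assms(1)] bounded_linear.bounded[OF assms(1)]
  by (auto simp: bounded_clinear_def)

lemma bounded_clinear_sum_scaleC:
  "bounded_clinear f \<Longrightarrow> f (\<Sum>b\<in>F. c b *\<^sub>C b) = (\<Sum>b\<in>F. c b *\<^sub>C f b)"
  by (simp add: bounded_clinear_bounded_linear[THEN bounded_linear.linear, THEN linear_sum]
      bounded_clinear_scaleC)

lemma bounded_clinear_shift:
  assumes "bounded_clinear R"
  shows "bounded_clinear (\<lambda>x. R x - l *\<^sub>C x)"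
proof (rule bounded_clinearI)
  show "bounded_linear (\<lambda>x. R x - l *\<^sub>C x)"
    by (intro bounded_linear_sub bounded_clinear_bounded_linear assms scaleC.bounded_linear_right)
qed (simp add: assms bounded_clinear_scaleC scaleC.diff_right scaleC_scaleC mult.commute)

lemma bounded_clinear_add_scaleC:
  assumes "bounded_clinear f" "bounded_clinear g"
  shows "bounded_clinear (\<lambda>x. f x + c *\<^sub>C g x)"
proof (rule bounded_clinearI)
  show "bounded_linear (\<lambda>x. f x + c *\<^sub>C g x)"
    by (intro bounded_linear_add bounded_linear_compose[OF scaleC.bounded_linear_right]
        bounded_clinear_bounded_linear assms)
qed (simp add: assms bounded_clinear_scaleC scaleC.add_right scaleC_scaleC mult.commute)

lemma bounded_clinear_compose:
  assumes "bounded_clinear f" "bounded_clinear g"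
  shows "bounded_clinear (\<lambda>x. f (g x))"
  using assms
  by (intro bounded_clinearI)
    (simp_all add: bounded_clinear_scaleC bounded_linear_compose bounded_clinear_bounded_linear)

text \<open>For finite \<open>B\<close> these are the closed subspaces of finite codimension used
  throughout; quantifying over finite sets replaces any talk of codimension.\<close>

definition orthocomp :: "'a::complex_inner set \<Rightarrow> 'a set" where
  "orthocomp B = {x. \<forall>b\<in>B. cinner b x = 0}"

lemma orthocompD:
  assumes "x \<in> orthocomp B" "b \<in> B"
  shows "cinner b x = 0" "cinner x b = 0"
  using assms cinner_zero_commute[of x b] by (simp_all add: orthocomp_def)

lemma subset_orthocomp_singleton: "B \<subseteq> orthocomp {x} \<longleftrightarrow> x \<in> orthocomp B"
  unfolding orthocomp_def using cinner_zero_commute by blast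

lemma orthocomp_Un: "orthocomp (B \<union> C) = orthocomp B \<inter> orthocomp C"
  and orthocomp_empty [simp]: "orthocomp {} = UNIV"
  and orthocomp_insert: "orthocomp (insert b B) = {x. cinner b x = 0} \<inter> orthocomp B"
  by (auto simp: orthocomp_def)

lemma csubspace_orthocomp: "csubspace (orthocomp B)"
  by (auto simp: csubspace_def orthocomp_def cinner_add_right cinner_scaleC_right cinner.zero_right)

lemma closed_orthocomp: "closed (orthocomp B)"
proof -
  have "orthocomp B = (\<Inter>b\<in>B. cinner b -` {0})"
    by (auto simp: orthocomp_def)
  moreover have "closed (cinner b -` {0})" for b :: 'a
    by (intro closed_vimage closed_singleton bounded_linear.continuous_on[OF cinner.bounded_linear_right]
        continuous_on_id)
  ultimately show ?thesis by auto
qed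

section \<open>Complex subspaces, spans and closures\<close>

lemma csubspace_add: "csubspace M \<Longrightarrow> x \<in> M \<Longrightarrow> y \<in> M \<Longrightarrow> x + y \<in> M"
  and csubspace_scaleC: "csubspace M \<Longrightarrow> x \<in> M \<Longrightarrow> c *\<^sub>C x \<in> M"
  and csubspace_zero: "csubspace M \<Longrightarrow> 0 \<in> M"
  by (simp_all add: csubspace_def)

lemma csubspace_scaleR: "csubspace M \<Longrightarrow> x \<in> M \<Longrightarrow> r *\<^sub>R x \<in> M"
  by (simp add: scaleR_scaleC csubspace_scaleC)

lemma csubspace_diff: "csubspace M \<Longrightarrow> x \<in> M \<Longrightarrow> y \<in> M \<Longrightarrow> x - y \<in> M"
  using csubspace_add[of M x "(-1) *\<^sub>R y"] csubspace_scaleR[of M y "-1"] by simp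

lemma csubspace_sum:
  "csubspace M \<Longrightarrow> (\<And>i. i \<in> F \<Longrightarrow> f i \<in> M) \<Longrightarrow> (\<Sum>i\<in>F. f i) \<in> M"
  by (induction F rule: infinite_finite_induct) (auto simp: csubspace_zero csubspace_add)

lemma csubspace_Int: "csubspace M \<Longrightarrow> csubspace N \<Longrightarrow> csubspace (M \<inter> N)"
  by (simp add: csubspace_def)

lemma sgn_in_csubspace:
  "csubspace M \<Longrightarrow> x \<in> M \<Longrightarrow> sgn x \<in> M"
  by (simp add: sgn_div_norm csubspace_scaleR)

lemma csubspace_cspan: "csubspace (cspan B)"
  unfolding csubspace_def
proof (intro conjI ballI allI)
  show "0 \<in> cspan B"
    unfolding cspan_def by (auto intro!: exI[of _ "{}"])
next
  fix x y assume "x \<in> cspan B" "y \<in> cspan B"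
  then obtain F c G d where *: "finite F" "F \<subseteq> B" "x = (\<Sum>b\<in>F. c b *\<^sub>C b)"
    "finite G" "G \<subseteq> B" "y = (\<Sum>b\<in>G. d b *\<^sub>C b)"
    unfolding cspan_def by blast
  define e where "e b = (if b \<in> F then c b else 0) + (if b \<in> G then d b else 0)" for b
  have "x = (\<Sum>b\<in>F\<union>G. (if b \<in> F then c b else 0) *\<^sub>C b)"
    unfolding * using * by (intro sum.mono_neutral_cong_left) auto
  moreover have "y = (\<Sum>b\<in>F\<union>G. (if b \<in> G then d b else 0) *\<^sub>C b)"
    unfolding * using * by (intro sum.mono_neutral_cong_left) auto
  ultimately have "x + y = (\<Sum>b\<in>F\<union>G. e b *\<^sub>C b)"
    by (simp add: e_def scaleC_add_left sum.distrib)
  with * show "x + y \<in> cspan B"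
    unfolding cspan_def by blast
next
  fix a x assume "x \<in> cspan B"
  then obtain F c where *: "finite F" "F \<subseteq> B" "x = (\<Sum>b\<in>F. c b *\<^sub>C b)"
    unfolding cspan_def by blast
  have "a *\<^sub>C x = (\<Sum>b\<in>F. (a * c b) *\<^sub>C b)"
    by (simp add: * scaleC.sum_right scaleC_scaleC)
  with * show "a *\<^sub>C x \<in> cspan B"
    unfolding cspan_def by (intro CollectI exI[of _ F] exI[of _ "\<lambda>b. a * c b"]) simp
qed

lemma cspan_superset: "B \<subseteq> cspan B"
proof
  fix b assume "b \<in> B"
  then show "b \<in> cspan B"
    unfolding cspan_def by (auto intro!: exI[of _ "{b}"] exI[of _ "\<lambda>_. 1"] simp: scaleC_one)
qed

lemma cspan_minimal: "csubspace M \<Longrightarrow> B \<subseteq> M \<Longrightarrow> cspan B \<subseteq> M"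
  unfolding cspan_def by (auto intro!: csubspace_sum csubspace_scaleC)

lemma cspan_mono: "B \<subseteq> C \<Longrightarrow> cspan B \<subseteq> cspan C"
  by (meson cspan_minimal csubspace_cspan cspan_superset order_trans)

lemma csubspace_closure:
  assumes "csubspace M"
  shows "csubspace (closure M)"
  unfolding csubspace_def
proof (intro conjI ballI allI)
  show "0 \<in> closure M"
    using assms closure_subset csubspace_zero by blast
next
  fix x y assume "x \<in> closure M" "y \<in> closure M"
  then obtain f g where "\<forall>n. f n \<in> M" "f \<longlonglongrightarrow> x" "\<forall>n. g n \<in> M" "g \<longlonglongrightarrow> y"
    unfolding closure_sequential by blast
  then show "x + y \<in> closure M"
    unfolding closure_sequential
    by (intro exI[of _ "\<lambda>n. f n + g n"]) (auto intro!: tendsto_intros csubspace_add assms)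
next
  fix c x assume "x \<in> closure M"
  then obtain f where "\<forall>n. f n \<in> M" "f \<longlonglongrightarrow> x"
    unfolding closure_sequential by blast
  then show "c *\<^sub>C x \<in> closure M"
    unfolding closure_sequential
    by (intro exI[of _ "\<lambda>n. c *\<^sub>C f n"])
      (auto intro!: scaleC.tendsto tendsto_const csubspace_scaleC assms)
qed

section \<open>Orthonormal sets and orthogonal projections\<close>

definition orthonormal :: "'a::complex_inner set \<Rightarrow> bool" where
  "orthonormal E \<longleftrightarrow> (\<forall>e\<in>E. norm e = 1) \<and> (\<forall>e\<in>E. \<forall>f\<in>E. e \<noteq> f \<longrightarrow> cinner e f = 0)"

lemma orthonormal_empty [simp]: "orthonormal {}"
  by (simp add: orthonormal_def)

lemma orthonormal_insert:
  "orthonormal E \<Longrightarrow> norm x = 1 \<Longrightarrow> x \<in> orthocomp E \<Longrightarrow> orthonormal (insert x E)"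
  by (auto simp: orthonormal_def orthocompD)

text \<open>This is the orthogonal projection onto \<open>cspan E\<close> when \<open>E\<close> is
  finite and orthonormal; for infinite \<open>E\<close> the sum takes its default value 0.\<close>

definition proj :: "'a::complex_inner set \<Rightarrow> 'a \<Rightarrow> 'a" where
  "proj E x = (\<Sum>e\<in>E. cinner e x *\<^sub>C e)"

lemma proj_in_cspan: "finite E \<Longrightarrow> proj E x \<in> cspan E"
  unfolding proj_def cspan_def
  by (intro CollectI exI[of _ E] exI[of _ "\<lambda>e. cinner e x"]) simp

lemma diff_proj_orthocomp:
  assumes "finite E" "orthonormal E"
  shows "x - proj E x \<in> orthocomp E"
  unfolding orthocomp_def
proof (intro CollectI ballI)
  fix b assume b: "b \<in> E"
  have "cinner b (proj E x) = (\<Sum>e\<in>E. cinner e x * cinner b e)"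
    by (simp add: proj_def cinner.sum_right cinner_scaleC_right)
  also have "\<dots> = (\<Sum>e\<in>E. if e = b then cinner e x else 0)"
    using assms b by (intro sum.cong) (auto simp: orthonormal_def cinner_same)
  also have "\<dots> = cinner b x"
    using assms b by simp
  finally show "cinner b (x - proj E x) = 0"
    by (simp add: cinner_diff_right)
qed

lemma bounded_clinear_proj: "bounded_clinear (proj E)"
proof (rule bounded_clinearI)
  show "bounded_linear (proj E)"
    unfolding proj_def [abs_def]
    by (intro bounded_linear_sum bounded_linear_compose[OF scaleC.bounded_linear_left]
        cinner.bounded_linear_right)
qed (simp add: proj_def cinner_scaleC_right scaleC.sum_right scaleC_scaleC)

lemma orthocomp_cspan_disjoint:
  assumes "x \<in> orthocomp B" "x \<in> cspan B"
  shows "x = 0"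
proof -
  have "B \<subseteq> orthocomp {x}"
    using assms(1) by (simp add: subset_orthocomp_singleton)
  then have "x \<in> orthocomp {x}"
    using assms(2) cspan_minimal[OF csubspace_orthocomp] by blast
  then show ?thesis
    by (simp add: orthocomp_def cinner_eq_zero_iff)
qed

lemma proj_eq_self:
  assumes "finite E" "orthonormal E" "x \<in> cspan E"
  shows "proj E x = x"
  using orthocomp_cspan_disjoint[OF diff_proj_orthocomp[OF assms(1,2)], of x]
    csubspace_diff[OF csubspace_cspan assms(3) proj_in_cspan[OF assms(1)], of x]
  by simp

lemma proj_orthocomp_eq_0: "x \<in> orthocomp E \<Longrightarrow> proj E x = 0"
  by (auto simp: proj_def orthocomp_def)

lemma norm_diff_proj_le:
  assumes "finite E" "orthonormal E"
  shows "norm (x - proj E x) \<le> norm x"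
proof -
  have "E \<subseteq> orthocomp {x - proj E x}"
    by (simp add: subset_orthocomp_singleton diff_proj_orthocomp assms)
  then have "cspan E \<subseteq> orthocomp {x - proj E x}"
    by (intro cspan_minimal csubspace_orthocomp)
  then have "proj E x \<in> orthocomp {x - proj E x}"
    using proj_in_cspan[OF assms(1), of x] by blast
  then have "cinner (x - proj E x) (proj E x) = 0"
    by (simp add: orthocomp_def)
  from norm_add_sq_orthogonal[OF this]
  have "(norm (x - proj E x))\<^sup>2 \<le> (norm x)\<^sup>2"
    by simp
  then show ?thesis
    by (simp add: power2_le_iff_abs_le)
qed

text \<open>Gram-Schmidt: a new vector \<open>b\<close> contributes its normalized residual
  \<open>w = b - proj E b\<close>, or nothing if the residual vanishes.\<close>

lemma ex_orthonormal_basis: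
  assumes "finite B"
  obtains E where "finite E" "orthonormal E" "cspan E = cspan B"
proof -
  from assms have "\<exists>E. finite E \<and> orthonormal E \<and> cspan E = cspan B"
  proof (induction B rule: finite_induct)
    case empty
    then show ?case by (intro exI[of _ "{}"]) simp
  next
    case (insert b B)
    then obtain E where E: "finite E" "orthonormal E" "cspan E = cspan B" by blast
    define w where "w = b - proj E b"
    have b: "b = w + proj E b" by (simp add: w_def)
    show ?case
    proof (cases "w = 0")
      case True
      then have "b \<in> cspan B"
        using b proj_in_cspan[OF E(1), of b] E(3) by simp
      then have "cspan (insert b B) = cspan B"
        by (intro subset_antisym cspan_minimal[OF csubspace_cspan] cspan_mono)
          (auto intro: subsetD[OF cspan_superset])
      with E show ?thesis by blast
    next
      case False
      let ?e = "sgn w"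
      have "?e \<in> orthocomp E"
        using diff_proj_orthocomp[OF E(1,2), of b]
        by (simp add: w_def sgn_in_csubspace csubspace_orthocomp)
      then have on: "orthonormal (insert ?e E)"
        using False E(2) by (simp add: orthonormal_insert norm_sgn)
      have EB: "cspan E \<subseteq> cspan (insert b B)"
        using E(3) cspan_mono[of B "insert b B"] by blast
      have "b \<in> cspan (insert b B)"
        using cspan_superset[of "insert b B"] by simp
      then have "w \<in> cspan (insert b B)"
        unfolding w_def using EB proj_in_cspan[OF E(1), of b]
        by (intro csubspace_diff csubspace_cspan) auto
      then have "?e \<in> cspan (insert b B)"
        by (simp add: sgn_in_csubspace csubspace_cspan)
      then have 1: "cspan (insert ?e E) \<subseteq> cspan (insert b B)"
        using EB cspan_superset[of E] by (intro cspan_minimal csubspace_cspan) auto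
      have EE: "cspan E \<subseteq> cspan (insert ?e E)"
        by (intro cspan_mono) auto
      have "?e \<in> cspan (insert ?e E)"
        using cspan_superset[of "insert ?e E"] by simp
      then have "norm w *\<^sub>R ?e \<in> cspan (insert ?e E)"
        by (intro csubspace_scaleR csubspace_cspan)
      then have "w \<in> cspan (insert ?e E)"
        using False by (simp add: sgn_div_norm)
      then have "b \<in> cspan (insert ?e E)"
        using EE proj_in_cspan[OF E(1), of b]
        by (subst b) (intro csubspace_add csubspace_cspan, auto)
      moreover have "B \<subseteq> cspan (insert ?e E)"
        using EE E(3) cspan_superset[of B] by simp
      ultimately have "cspan (insert b B) \<subseteq> cspan (insert ?e E)"
        by (intro cspan_minimal csubspace_cspan) auto
      with 1 on E(1) show ?thesis
        by (intro exI[of _ "insert ?e E"]) auto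
    qed
  qed
  then show thesis
    using that by auto
qed

lemma orthocomp_cspan: "orthocomp (cspan B) = orthocomp B"
proof
  show "orthocomp (cspan B) \<subseteq> orthocomp B"
    using cspan_superset[of B] by (auto simp: orthocomp_def)
  show "orthocomp B \<subseteq> orthocomp (cspan B)"
  proof
    fix x assume "x \<in> orthocomp B"
    then have "B \<subseteq> orthocomp {x}"
      by (simp add: subset_orthocomp_singleton)
    then have "cspan B \<subseteq> orthocomp {x}"
      by (intro cspan_minimal csubspace_orthocomp)
    then show "x \<in> orthocomp (cspan B)"
      by (simp add: subset_orthocomp_singleton)
  qed
qed

lemma ex_orthonormal_orthocomp:
  assumes "finite B"
  obtains E where "finite E" "orthonormal E" "orthocomp E = orthocomp B"
  using ex_orthonormal_basis[OF assms] orthocomp_cspan by metis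

text \<open>In infinite dimension some \<open>y\<close> lies outside the span of \<open>B\<close>;
  its residual after projection is nonzero and orthogonal to \<open>B\<close>.\<close>

lemma ex_unit_orthocomp:
  fixes B :: "'a::complex_inner set"
  assumes "\<not> finite_dim_set (UNIV :: 'a set)" "finite B"
  obtains x where "norm x = 1" "x \<in> orthocomp B"
proof -
  obtain E where E: "finite E" "orthonormal E" "orthocomp E = orthocomp B"
    using ex_orthonormal_orthocomp[OF assms(2)] .
  obtain y where "y \<notin> cspan E"
    using assms(1) E(1) unfolding finite_dim_set_def by blast
  then have "y - proj E y \<noteq> 0"
    using proj_in_cspan[OF E(1), of y] by auto
  moreover have "y - proj E y \<in> orthocomp B"
    using diff_proj_orthocomp[OF E(1,2)] E(3) by simp
  ultimately show thesis
    by (intro that[of "sgn (y - proj E y)"] sgn_in_csubspace csubspace_orthocomp)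
      (simp_all add: norm_sgn)
qed

text \<open>Each functional \<open>cinner b\<close> lowers the dimension by at most one: if it does
  not vanish at some \<open>v\<close> in \<open>M\<close>, then \<open>M\<close> is spanned by
  \<open>v\<close> and its kernel in \<open>M\<close>.\<close>

lemma finite_dim_of_Int_orthocomp:
  assumes "finite B" "csubspace M" "M \<inter> orthocomp B \<subseteq> {0}"
  shows "finite_dim_set M"
  using assms
proof (induction B arbitrary: M rule: finite_induct)
  case empty
  then show ?case
    unfolding finite_dim_set_def by (intro exI[of _ "{}"]) (auto simp: csubspace_zero[OF csubspace_cspan])
next
  case (insert b B)
  let ?N = "M \<inter> orthocomp {b}"
  have "finite_dim_set ?N"
    using insert.prems
    by (intro insert.IH csubspace_Int csubspace_orthocomp) (auto simp: orthocomp_def)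
  then obtain C where C: "finite C" "?N \<subseteq> cspan C"
    unfolding finite_dim_set_def by blast
  show ?case
  proof (cases "M \<subseteq> orthocomp {b}")
    case True
    then show ?thesis
      using C unfolding finite_dim_set_def by (intro exI[of _ C]) auto
  next
    case False
    then obtain v where v: "v \<in> M" "cinner b v \<noteq> 0"
      by (auto simp: orthocomp_def)
    have "x \<in> cspan (insert v C)" if "x \<in> M" for x
    proof -
      define t where "t = cinner b x / cinner b v"
      have "x - t *\<^sub>C v \<in> ?N"
        using that v insert.prems(1)
        by (auto simp: orthocomp_def cinner_diff_right cinner_scaleC_right t_def
            intro!: csubspace_diff csubspace_scaleC)
      then have "x - t *\<^sub>C v \<in> cspan (insert v C)"
        using C(2) cspan_mono[of C "insert v C"] by blast
      moreover have "t *\<^sub>C v \<in> cspan (insert v C)"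
        using cspan_superset[of "insert v C"] by (intro csubspace_scaleC csubspace_cspan) auto
      ultimately have "x - t *\<^sub>C v + t *\<^sub>C v \<in> cspan (insert v C)"
        by (intro csubspace_add csubspace_cspan)
      then show ?thesis by simp
    qed
    then show ?thesis
      using C(1) unfolding finite_dim_set_def by (intro exI[of _ "insert v C"]) auto
  qed
qed

section \<open>Compact operators\<close>

text \<open>The working form of compactness: arbitrarily small norm on suitable subspaces of finite
  codimension. Such smallness can be read off quadratic forms and passes to sums and to corners of
  block operators.\<close>

definition finitely_small :: "('a::complex_inner \<Rightarrow> 'b::complex_inner) \<Rightarrow> bool" where
  "finitely_small X \<longleftrightarrow>
     (\<forall>\<epsilon>>0. \<exists>B. finite B \<and> (\<forall>x\<in>orthocomp B. norm (X x) \<le> \<epsilon> * norm x))"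

lemma finitely_smallE:
  assumes "finitely_small X" "\<epsilon> > 0"
  obtains B where "finite B" "\<And>x. x \<in> orthocomp B \<Longrightarrow> norm (X x) \<le> \<epsilon> * norm x"
  using assms unfolding finitely_small_def by meson

lemma finitely_small_orthonormalE:
  assumes "finitely_small X" "\<epsilon> > 0"
  obtains E where "finite E" "orthonormal E" "\<And>x. x \<in> orthocomp E \<Longrightarrow> norm (X x) \<le> \<epsilon> * norm x"
proof -
  obtain B where B: "finite B" "\<And>x. x \<in> orthocomp B \<Longrightarrow> norm (X x) \<le> \<epsilon> * norm x"
    using finitely_smallE[OF assms] by metis
  obtain E where "finite E" "orthonormal E" "orthocomp E = orthocomp B"
    using ex_orthonormal_orthocomp[OF B(1)] .
  with B show thesis
    by (intro that[of E]) auto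
qed

text \<open>By induction the set is a Minkowski sum of finitely many continuous images of a closed
  disc.\<close>

lemma compact_combinations:
  fixes f :: "'i \<Rightarrow> 'b::complex_inner"
  assumes "finite E"
  shows "compact {\<Sum>e\<in>E. t e *\<^sub>C f e | t. \<forall>e\<in>E. cmod (t e) \<le> r}" (is "compact (?S E)")
  using assms
proof (induction E rule: finite_induct)
  case empty
  then show ?case by simp
next
  case (insert a E)
  have "?S (insert a E) = {x + y | x y. x \<in> (\<lambda>t. t *\<^sub>C f a) ` cball 0 r \<and> y \<in> ?S E}"
  proof (intro subset_antisym subsetI)
    fix z assume "z \<in> ?S (insert a E)"
    then obtain t where "\<forall>e\<in>insert a E. cmod (t e) \<le> r" "z = (\<Sum>e\<in>insert a E. t e *\<^sub>C f e)"
      by blast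
    with insert.hyps show "z \<in> {x + y | x y. x \<in> (\<lambda>t. t *\<^sub>C f a) ` cball 0 r \<and> y \<in> ?S E}"
      by (intro CollectI exI[of _ "t a *\<^sub>C f a"] exI[of _ "\<Sum>e\<in>E. t e *\<^sub>C f e"]) auto
  next
    fix z assume "z \<in> {x + y | x y. x \<in> (\<lambda>t. t *\<^sub>C f a) ` cball 0 r \<and> y \<in> ?S E}"
    then obtain s t where st: "cmod s \<le> r" "\<forall>e\<in>E. cmod (t e) \<le> r"
      "z = s *\<^sub>C f a + (\<Sum>e\<in>E. t e *\<^sub>C f e)"
      by auto
    have "(\<Sum>e\<in>E. (t(a := s)) e *\<^sub>C f e) = (\<Sum>e\<in>E. t e *\<^sub>C f e)"
      using insert.hyps by (intro sum.cong) auto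
    with st insert.hyps show "z \<in> ?S (insert a E)"
      by (intro CollectI exI[of _ "t(a := s)"]) auto
  qed
  moreover have "compact ((\<lambda>t. t *\<^sub>C f a) ` cball 0 r)"
    by (intro compact_continuous_image bounded_linear.continuous_on[OF scaleC.bounded_linear_left]
        continuous_on_id compact_cball)
  ultimately show ?case
    using compact_sums[OF _ insert.IH] by presburger
qed

text \<open>Total boundedness: the unit ball splits into a finite-dimensional part, whose image lies
  in a compact set, and a part orthogonal to \<open>E\<close>, whose image is uniformly
  small.\<close>

lemma compact_closure_finitely_small:
  fixes X :: "'a::complex_inner \<Rightarrow> 'b::{complex_inner, complete_space}"
  assumes "bounded_clinear X" "finitely_small X"
  shows "compact (closure (X ` cball 0 1))"
  unfolding compact_eq_totally_bounded
proof (intro conjI allI impI)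
  show "complete (closure (X ` cball 0 1))"
    by (simp add: complete_eq_closed)
  fix \<epsilon> :: real assume "\<epsilon> > 0"
  then have "\<epsilon> / 4 > 0" by simp
  then obtain E where E: "finite E" "orthonormal E"
    "\<And>x. x \<in> orthocomp E \<Longrightarrow> norm (X x) \<le> \<epsilon> / 4 * norm x"
    using finitely_small_orthonormalE[OF assms(2)] by blast
  let ?S = "{\<Sum>e\<in>E. t e *\<^sub>C X e | t. \<forall>e\<in>E. cmod (t e) \<le> 1}"
  have "compact ?S"
    by (rule compact_combinations[OF E(1)])
  then obtain k where k: "finite k" "?S \<subseteq> (\<Union>x\<in>k. ball x (\<epsilon> / 4))"
    unfolding compact_eq_totally_bounded using \<open>\<epsilon> / 4 > 0\<close> by meson
  \<comment> \<open>Closed balls of half the radius are used because their finite union is closed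
    and so also covers the closure of the image.\<close>
  have "X ` cball 0 1 \<subseteq> (\<Union>x\<in>k. cball x (\<epsilon> / 2))"
  proof (intro image_subsetI)
    fix x :: 'a assume x: "x \<in> cball 0 1"
    have "cmod (cinner e x) \<le> 1" if "e \<in> E" for e
      using norm_cinner_le[of e x] that E(2) x by (simp add: orthonormal_def)
    then have "X (proj E x) \<in> ?S"
      unfolding proj_def
      by (intro CollectI exI[of _ "\<lambda>e. cinner e x"] conjI)
        (simp_all add: linear_sum[OF bounded_linear.linear[OF bounded_clinear_bounded_linear]]
          bounded_clinear_scaleC assms(1))
    then obtain c where c: "c \<in> k" "dist c (X (proj E x)) < \<epsilon> / 4"
      using k(2) by auto
    have "norm (X (x - proj E x)) \<le> \<epsilon> / 4 * norm (x - proj E x)"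
      by (intro E(3) diff_proj_orthocomp E(1,2))
    also have "\<dots> \<le> \<epsilon> / 4 * 1"
      using norm_diff_proj_le[OF E(1,2), of x] x \<open>\<epsilon> > 0\<close> by (intro mult_left_mono) auto
    finally have "dist (X (proj E x)) (X x) \<le> \<epsilon> / 4"
      using bounded_clinear_add[OF assms(1), of "x - proj E x" "proj E x"]
      by (simp add: dist_norm norm_minus_commute)
    with c have "dist c (X x) \<le> \<epsilon> / 2"
      using dist_triangle[of c "X x" "X (proj E x)"] by simp
    with c(1) show "X x \<in> (\<Union>x\<in>k. cball x (\<epsilon> / 2))" by auto
  qed
  moreover have "closed (\<Union>x\<in>k. cball x (\<epsilon> / 2))"
    using k(1) by auto
  ultimately have "closure (X ` cball 0 1) \<subseteq> (\<Union>x\<in>k. cball x (\<epsilon> / 2))"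
    by (rule closure_minimal)
  also have "\<dots> \<subseteq> (\<Union>x\<in>k. ball x \<epsilon>)"
    using \<open>\<epsilon> > 0\<close> by force
  finally show "\<exists>k. finite k \<and> closure (X ` cball 0 1) \<subseteq> (\<Union>x\<in>k. ball x \<epsilon>)"
    using k(1) by blast
qed

lemma finitely_small_subseq:
  fixes X :: "'a::complex_inner \<Rightarrow> 'b::{complex_inner, complete_space}"
  assumes "bounded_clinear X" "finitely_small X" "\<And>n. norm (x n) \<le> 1"
  obtains r where "strict_mono (r :: nat \<Rightarrow> nat)" "Cauchy (\<lambda>n. X (x (r n)))"
proof -
  have "seq_compact (closure (X ` cball 0 1))"
    using compact_closure_finitely_small[OF assms(1,2)] by (simp add: compact_eq_seq_compact_metric)
  moreover have "\<forall>n. X (x n) \<in> closure (X ` cball 0 1)"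
    using assms(3) closure_subset by fastforce
  ultimately obtain l r where "strict_mono (r :: nat \<Rightarrow> nat)" "((\<lambda>n. X (x n)) \<circ> r) \<longlonglongrightarrow> l"
    by (rule seq_compactE)
  then show thesis
    using that[of r] LIMSEQ_imp_Cauchy[of "(\<lambda>n. X (x n)) \<circ> r"] by (simp add: comp_def)
qed

section \<open>Suprema of quadratic forms of compact operators\<close>

lemma cinner_form_le:
  assumes "bounded_linear K" "csubspace M"
    and "\<And>x. x \<in> M \<Longrightarrow> norm x = 1 \<Longrightarrow> Re (cinner x (K x)) \<le> s" "x \<in> M"
  shows "Re (cinner x (K x)) \<le> s * (norm x)\<^sup>2"
proof (cases "x = 0")
  case True
  then show ?thesis by (simp add: cinner.zero_left)
next
  case False
  have "Re (cinner (sgn x) (K (sgn x))) \<le> s"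
    using False assms by (simp add: norm_sgn sgn_in_csubspace)
  moreover have "Re (cinner (sgn x) (K (sgn x))) = Re (cinner x (K x)) / (norm x)\<^sup>2"
    by (simp add: sgn_div_norm linear_scale[OF bounded_linear.linear[OF assms(1)]]
        cinner.scaleR_left cinner.scaleR_right power2_eq_square divide_simps)
  ultimately show ?thesis
    using False by (simp add: field_simps)
qed

text \<open>The form \<open>s |x|\<^sup>2 - \<langle>x, K x\<rangle>\<close> is nonnegative on \<open>M\<close>, so by the parallelogram law
  it is small on differences of members of a maximizing sequence; as \<open>K\<close> is compact and \<open>s > 0\<close>,
  a subsequence is Cauchy.\<close>

lemma cinner_form_sup_attained:
  fixes K :: "'a::{complex_inner, complete_space} \<Rightarrow> 'a"
  assumes K: "bounded_clinear K" "finitely_small K"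
    and M: "csubspace M" "closed M"
    and s: "s > 0" "\<And>x. x \<in> M \<Longrightarrow> norm x = 1 \<Longrightarrow> Re (cinner x (K x)) \<le> s"
    and sup: "\<And>\<epsilon>. \<epsilon> > 0 \<Longrightarrow> \<exists>x\<in>M. norm x = 1 \<and> Re (cinner x (K x)) > s - \<epsilon>"
  shows "\<exists>x\<in>M. norm x = 1 \<and> Re (cinner x (K x)) = s"
proof -
  note lin = bounded_clinear_bounded_linear[OF K(1)]
  define f where "f x = s * (norm x)\<^sup>2 - Re (cinner x (K x))" for x
  have f_nonneg: "f x \<ge> 0" if "x \<in> M" for x
    using cinner_form_le[OF lin M(1) s(2) that] by (simp add: f_def)
  have par: "f (x - y) + f (x + y) = 2 * f x + 2 * f y" for x y
    by (simp add: f_def Re_cinner_same[symmetric] cinner.add_left cinner.add_right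
        cinner.diff_left cinner.diff_right linear_add linear_diff bounded_linear.linear[OF lin]
        algebra_simps)
  obtain x where x: "\<And>n. x n \<in> M" "\<And>n. norm (x n) = 1" "\<And>n. Re (cinner (x n) (K (x n))) > s - 1 / Suc n"
  proof -
    have "\<forall>n. \<exists>x. x \<in> M \<and> norm x = 1 \<and> Re (cinner x (K x)) > s - 1 / Suc n"
      using sup by (simp add: Bex_def)
    then show thesis
      using that by (auto dest!: choice)
  qed
  obtain r where r: "strict_mono (r :: nat \<Rightarrow> nat)" "Cauchy (\<lambda>n. K (x (r n)))"
    using finitely_small_subseq[OF K, of x] x(2) by auto
  define y where "y n = x (r n)" for n
  have y: "y n \<in> M" "norm (y n) = 1" for n
    by (simp_all add: y_def x)
  have fy: "f (y n) \<le> 1 / Suc n" for n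
  proof -
    have "f (y n) < 1 / Suc (r n)"
      using x(2,3)[of "r n"] by (simp add: f_def y_def)
    also have "\<dots> \<le> 1 / Suc n"
      using seq_suble[OF r(1), of n] by (simp add: frac_le)
    finally show ?thesis by simp
  qed
  have "Cauchy y"
  proof (rule metric_CauchyI)
    fix e :: real assume "e > 0"
    \<comment> \<open>The two values of \<open>f\<close> contribute less than 4 \<delta> and the
      compact part at most 2 \<delta> to \<open>s * (norm ?d)\<^sup>2\<close>, which therefore stays
      below 8 \<delta>, that is, below \<open>s * e\<^sup>2\<close>.\<close>
    define \<delta> where "\<delta> = s * e\<^sup>2 / 8"
    have "\<delta> > 0" using s(1) \<open>e > 0\<close> by (simp add: \<delta>_def)
    obtain N1 where N1: "\<And>m n. m \<ge> N1 \<Longrightarrow> n \<ge> N1 \<Longrightarrow> dist (K (y m)) (K (y n)) < \<delta>"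
      using r(2) \<open>\<delta> > 0\<close> unfolding Cauchy_def y_def by blast
    obtain N2 where N2: "1 / Suc N2 < \<delta>"
      using \<open>\<delta> > 0\<close> nat_approx_posE by blast
    have fN: "f (y n) < \<delta>" if "n \<ge> N2" for n
    proof -
      have "1 / Suc n \<le> 1 / Suc N2" using that by (simp add: frac_le)
      with fy[of n] N2 show ?thesis by simp
    qed
    show "\<exists>N. \<forall>m\<ge>N. \<forall>n\<ge>N. dist (y m) (y n) < e"
    proof (intro exI[of _ "max N1 N2"] allI impI)
      fix m n assume mn: "m \<ge> max N1 N2" "n \<ge> max N1 N2"
      let ?d = "y m - y n"
      have "norm ?d \<le> 2"
        using norm_triangle_ineq4[of "y m" "y n"] y by simp
      have "Re (cinner ?d (K ?d)) \<le> norm ?d * norm (K ?d)"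
        by (rule Re_cinner_le)
      also have "\<dots> \<le> 2 * \<delta>"
        using \<open>norm ?d \<le> 2\<close> N1[of m n] mn
        by (intro mult_mono) (auto simp: dist_norm linear_diff bounded_linear.linear[OF lin])
      finally have "Re (cinner ?d (K ?d)) \<le> 2 * \<delta>" .
      moreover have "f ?d \<le> 2 * f (y m) + 2 * f (y n)"
        using par[of "y m" "y n"] f_nonneg[of "y m + y n"] y M(1) by (simp add: csubspace_add)
      ultimately have "s * (norm ?d)\<^sup>2 < 8 * \<delta>"
        using fN[of m] fN[of n] mn \<open>\<delta> > 0\<close> by (simp add: f_def)
      then have "(norm ?d)\<^sup>2 < e\<^sup>2"
        using s(1) by (simp add: \<delta>_def)
      then show "dist (y m) (y n) < e"
        using \<open>e > 0\<close> by (simp add: dist_norm power2_less_imp_less)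
    qed
  qed
  then obtain z where z: "y \<longlonglongrightarrow> z"
    using Cauchy_convergent_iff convergent_def by blast
  have "z \<in> M"
    using closed_sequentially[OF M(2) _ z] y by blast
  moreover have "norm z = 1"
    using tendsto_norm[OF z] y by (simp add: LIMSEQ_const_iff)
  moreover have "(\<lambda>n. f (y n)) \<longlonglongrightarrow> f z"
    unfolding f_def
    by (intro tendsto_intros cinner.tendsto bounded_linear.tendsto[OF lin] z)
  then have "f z \<le> 0"
    by (rule LIMSEQ_le[OF _ LIMSEQ_inverse_real_of_nat]) (use fy in \<open>auto simp: inverse_eq_divide\<close>)
  ultimately show ?thesis
    using f_nonneg[of z] by (intro bexI[of _ z]) (auto simp: f_def)
qed

section \<open>Norm attainment on closed subspaces\<close>

lemma positive_op_bounded_clinear: "positive_op A \<Longrightarrow> bounded_clinear A"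
  by (simp add: positive_op_def)

text \<open>Polarization: the form is real at \<open>x + y\<close> and at
  \<open>x + \<i> *\<^sub>C y\<close>, which fixes the imaginary and the real part of the difference
  between \<open>cinner y (A x)\<close> and the conjugate of \<open>cinner x (A y)\<close>.\<close>

lemma positive_op_selfadjoint:
  assumes "positive_op A"
  shows "is_adjoint A A"
  unfolding is_adjoint_def
proof (intro allI)
  fix x y
  note A = positive_op_bounded_clinear[OF assms]
  have im: "Im (cinner z (A z)) = 0" for z
    using assms by (simp add: positive_op_def)
  have "Im (cinner x (A y)) + Im (cinner y (A x)) = 0"
    using im[of "x + y"] im[of x] im[of y]
    by (simp add: bounded_clinear_add[OF A] cinner_add_left cinner_add_right)
  moreover have "Re (cinner x (A y)) - Re (cinner y (A x)) = 0"
    using im[of "x + \<i> *\<^sub>C y"] im[of x] im[of y]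
    by (simp add: bounded_clinear_add[OF A] bounded_clinear_scaleC[OF A] cinner_add_left cinner_add_right
        cinner_scaleC_left cinner_scaleC_right)
  ultimately have "cinner y (A x) = cnj (cinner x (A y))"
    by (simp add: complex_eq_iff)
  then show "cinner (A x) y = cinner x (A y)"
    using cinner_commute[of "A x" y] by simp
qed

lemma is_adjointD: "is_adjoint X Y \<Longrightarrow> cinner (X x) y = cinner x (Y y)"
  by (simp add: is_adjoint_def)

lemma norm_sq_selfadjoint:
  "is_adjoint T T \<Longrightarrow> (norm (T x))\<^sup>2 = Re (cinner x (T (T x)))"
  by (simp add: Re_cinner_same[symmetric] is_adjointD)

lemma norm_image_sgn_sq:
  assumes "bounded_linear T" "x \<noteq> 0"
  shows "(norm (T (sgn x)))\<^sup>2 = (norm (T x))\<^sup>2 / (norm x)\<^sup>2"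
  by (simp add: sgn_div_norm linear_scale[OF bounded_linear.linear[OF assms(1)]] power_mult_distrib
      divide_inverse power_inverse mult.commute)

lemma norm_image_sq_le:
  assumes "bounded_linear T" "csubspace M"
    and "\<And>x. x \<in> M \<Longrightarrow> norm x = 1 \<Longrightarrow> (norm (T x))\<^sup>2 \<le> c" "x \<in> M"
  shows "(norm (T x))\<^sup>2 \<le> c * (norm x)\<^sup>2"
proof (cases "x = 0")
  case True
  then show ?thesis by (simp add: linear_0 bounded_linear.linear[OF assms(1)])
next
  case False
  have "(norm (T (sgn x)))\<^sup>2 \<le> c"
    using False assms by (simp add: norm_sgn sgn_in_csubspace)
  with False show ?thesis
    by (simp add: norm_image_sgn_sq[OF assms(1)] field_simps)
qed

lemma bdd_above_norm_image_unit:
  assumes "bounded_linear S"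
  shows "bdd_above ((\<lambda>y. norm (S y)) ` {y \<in> M. norm y = 1})"
proof -
  obtain K where K: "\<And>y. norm (S y) \<le> norm y * K"
    using bounded_linear.bounded[OF assms] by blast
  have "norm (S y) \<le> K" if "norm y = 1" for y
    using K[of y] that by simp
  then show ?thesis
    by (intro bdd_aboveI[of _ K]) auto
qed

text \<open>Boundedness makes the norms on the unit sphere of \<open>M\<close> bounded above, so
  that \<open>SUP\<close> really dominates them; attainment can then be treated as the existence of
  a maximum.\<close>

lemma norm_attaining_on_iff:
  assumes "bounded_linear S"
  shows "norm_attaining_on M S \<longleftrightarrow>
    (\<exists>x\<in>M. norm x = 1 \<and> (\<forall>y\<in>M. norm y = 1 \<longrightarrow> norm (S y) \<le> norm (S x)))"
proof
  assume "norm_attaining_on M S"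
  then obtain x where x: "x \<in> M" "norm x = 1" "norm (S x) = (SUP y\<in>{y\<in>M. norm y = 1}. norm (S y))"
    unfolding norm_attaining_on_def by blast
  have "norm (S y) \<le> norm (S x)" if "y \<in> M" "norm y = 1" for y
    unfolding x(3) using that by (intro cSUP_upper bdd_above_norm_image_unit assms) auto
  with x show "\<exists>x\<in>M. norm x = 1 \<and> (\<forall>y\<in>M. norm y = 1 \<longrightarrow> norm (S y) \<le> norm (S x))"
    by blast
next
  assume "\<exists>x\<in>M. norm x = 1 \<and> (\<forall>y\<in>M. norm y = 1 \<longrightarrow> norm (S y) \<le> norm (S x))"
  then obtain x where x: "x \<in> M" "norm x = 1" "\<And>y. y \<in> M \<Longrightarrow> norm y = 1 \<Longrightarrow> norm (S y) \<le> norm (S x)"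
    by blast
  then have "(SUP y\<in>{y\<in>M. norm y = 1}. norm (S y)) = norm (S x)"
    by (intro cSup_eq_maximum) auto
  with x show "norm_attaining_on M S"
    unfolding norm_attaining_on_def by auto
qed

text \<open>If \<open>x\<close> attains the norm of \<open>T\<close> on the closed span \<open>M\<close> of the \<open>z i\<close>, then removing from \<open>x\<close>
  its component along some \<open>z i\<close> would increase the quotient \<open>|T x| / |x|\<close>; so \<open>x\<close> is orthogonal
  to \<open>M\<close>.\<close>

lemma AN_no_increasing_sequence:
  fixes T :: "'a::{complex_inner, complete_space} \<Rightarrow> 'a" and z :: "nat \<Rightarrow> 'a"
  assumes T: "AN T" "is_adjoint T T"
    and z: "\<And>n. norm (z n) = 1" "\<And>i j. i \<noteq> j \<Longrightarrow> cinner (z i) (z j) = 0"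
      "\<And>i j. i \<noteq> j \<Longrightarrow> cinner (z i) (T (T (z j))) = 0"
      "\<And>n. (norm (T (z n)))\<^sup>2 < (norm (T (z (Suc n))))\<^sup>2"
  shows False
proof -
  have bcl: "bounded_clinear T"
    using T(1) by (simp add: AN_def)
  note lin = bounded_clinear_bounded_linear[OF bcl]
  define M where "M = closure (cspan (range z))"
  have M: "csubspace M" "closed M"
    by (simp_all add: M_def csubspace_closure csubspace_cspan)
  have zM: "z i \<in> M" for i
    unfolding M_def using cspan_superset[of "range z"] closure_subset[of "cspan (range z)"] by blast
  have M_least: "M \<subseteq> orthocomp B" if "range z \<subseteq> orthocomp B" for B
    unfolding M_def using that
    by (intro closure_minimal cspan_minimal csubspace_orthocomp closed_orthocomp)
  have "M \<noteq> {0}"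
    using zM[of 0] z(1)[of 0] by force
  then obtain x where x: "x \<in> M" "norm x = 1"
    and max: "\<And>y. y \<in> M \<Longrightarrow> norm y = 1 \<Longrightarrow> norm (T y) \<le> norm (T x)"
    using T(1) M unfolding AN_def norm_attaining_on_iff[OF lin] by blast
  define s where "s = (norm (T x))\<^sup>2"
  have le: "(norm (T y))\<^sup>2 \<le> s * (norm y)\<^sup>2" if "y \<in> M" for y
    unfolding s_def using that
    by (intro norm_image_sq_le[OF lin M(1)] power_mono max) auto
  have "cinner (z i) x = 0" for i
  proof -
    define a where "a = cinner (z i) x"
    define w where "w = x - a *\<^sub>C z i"
    define c where "c = (norm (T (z i)))\<^sup>2"
    have wM: "w \<in> M"
      unfolding w_def by (intro csubspace_diff csubspace_scaleC M(1) x(1) zM)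
    have zw: "cinner (z i) w = 0"
      by (simp add: w_def a_def cinner_diff_right cinner_scaleC_right cinner_same z(1))
    have "cinner (z i) (T (T (z i))) = c"
      using cinner_same[of "T (z i)"] by (simp add: c_def is_adjointD[OF T(2)])
    \<comment> \<open>\<open>T (T (z i)) - c *\<^sub>C z i\<close> is orthogonal to every
      \<open>z j\<close>, hence to all of \<open>M\<close>. So the splitting of \<open>x\<close>
      into \<open>a *\<^sub>C z i\<close> and \<open>w\<close> is orthogonal also for the form of
      \<open>T\<close>.\<close>
    then have "z j \<in> orthocomp {T (T (z i)) - c *\<^sub>C z i}" for j
      by (cases "j = i") (auto simp: orthocomp_def z cinner.diff_left cinner_scaleC_left
          is_adjointD[OF T(2)] cinner_same)
    then have "w \<in> orthocomp {T (T (z i)) - c *\<^sub>C z i}"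
      using M_least wM by blast
    then have "cinner (T (z i)) (T w) = 0"
      by (simp add: orthocomp_def cinner.diff_left cinner_scaleC_left zw is_adjointD[OF T(2)])
    then have "(norm (T (a *\<^sub>C z i) + T w))\<^sup>2 = (norm (T (a *\<^sub>C z i)))\<^sup>2 + (norm (T w))\<^sup>2"
      by (intro norm_add_sq_orthogonal)
        (simp add: bounded_clinear_scaleC[OF bcl] cinner_scaleC_left)
    moreover have "T (a *\<^sub>C z i) + T w = T x"
      unfolding w_def bounded_clinear_add[OF bcl, symmetric] by simp
    ultimately have "s = (cmod a)\<^sup>2 * c + (norm (T w))\<^sup>2"
      by (simp add: s_def c_def bounded_clinear_scaleC[OF bcl] norm_scaleC power_mult_distrib)
    moreover have "(norm (a *\<^sub>C z i + w))\<^sup>2 = (norm (a *\<^sub>C z i))\<^sup>2 + (norm w)\<^sup>2"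
      using zw by (intro norm_add_sq_orthogonal) (simp add: cinner_scaleC_left)
    then have "1 = (cmod a)\<^sup>2 + (norm w)\<^sup>2"
      by (simp add: norm_scaleC z(1)) (simp add: w_def x(2))
    then have "(norm w)\<^sup>2 = 1 - (cmod a)\<^sup>2"
      by simp
    then have "(norm (T w))\<^sup>2 \<le> s * (1 - (cmod a)\<^sup>2)"
      using le[OF wM] by simp
    ultimately have "(cmod a)\<^sup>2 * (s - c) \<le> 0"
      by (simp add: algebra_simps)
    \<comment> \<open>The next member of the sequence has a strictly larger value, and
      \<open>s\<close> bounds that value too. This forces \<open>a = 0\<close>.\<close>
    moreover have "c < s"
      using z(4)[of i] le[OF zM[of "Suc i"]] z(1) by (simp add: c_def)
    ultimately show ?thesis
      by (simp add: a_def mult_le_0_iff)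
  qed
  then have "range z \<subseteq> orthocomp {x}"
    by (auto simp: orthocomp_def cinner_zero_commute[of x "z _"])
  then have "x \<in> orthocomp {x}"
    using M_least x(1) by blast
  then show False
    using x(2) by (auto simp: orthocomp_def cinner_eq_zero_iff)
qed

text \<open>The upper bounds hold by the choice of \<beta> as an infimum. If the lower bound failed
  on every subspace of finite codimension, values strictly between any \<open>c < \<beta>\<close>
  and \<beta> would occur orthogonally to any finite set, giving a sequence excluded by
  \<open>AN_no_increasing_sequence\<close>.\<close>

lemma AN_quadratic_form_bounds:
  fixes T :: "'a::{complex_inner, complete_space} \<Rightarrow> 'a"
  assumes T: "AN T" "is_adjoint T T" and inf: "\<not> finite_dim_set (UNIV :: 'a set)"
  obtains \<beta> where "\<beta> \<ge> 0"
    and "\<And>c. c > \<beta> \<Longrightarrow> \<exists>B. finite B \<and> (\<forall>x\<in>orthocomp B. (norm (T x))\<^sup>2 \<le> c * (norm x)\<^sup>2)"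
    and "\<exists>B. finite B \<and> (\<forall>x\<in>orthocomp B. \<beta> * (norm x)\<^sup>2 \<le> (norm (T x))\<^sup>2)"
proof -
  have bcl: "bounded_clinear T"
    using T(1) by (simp add: AN_def)
  note lin = bounded_clinear_bounded_linear[OF bcl]
  define q where "q x = (norm (T x))\<^sup>2" for x
  define C where "C = {c. \<exists>B. finite B \<and> (\<forall>x\<in>orthocomp B. q x \<le> c * (norm x)\<^sup>2)}"
  define \<beta> where "\<beta> = Inf C"
  have C_nonneg: "c \<ge> 0" if "c \<in> C" for c
  proof -
    obtain B where B: "finite B" "\<forall>x\<in>orthocomp B. q x \<le> c * (norm x)\<^sup>2"
      using \<open>c \<in> C\<close> unfolding C_def by blast
    obtain x where "norm x = 1" "x \<in> orthocomp B"
      using ex_unit_orthocomp[OF inf B(1)] .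
    then have "0 \<le> q x" "q x \<le> c"
      using B(2) by (auto simp: q_def)
    then show ?thesis by simp
  qed
  then have bdd: "bdd_below C"
    by (rule bdd_belowI)
  obtain k where k: "\<And>x. norm (T x) \<le> norm x * k"
    using bounded_linear.bounded[OF lin] by blast
  have "k\<^sup>2 \<in> C"
    unfolding C_def q_def
    using power_mono[OF k norm_ge_zero, of _ 2]
    by (intro CollectI exI[of _ "{}"]) (auto simp: power_mult_distrib mult.commute)
  then have "C \<noteq> {}" by blast
  then have "\<beta> \<ge> 0"
    unfolding \<beta>_def by (rule cInf_greatest) (rule C_nonneg)
  have above: "\<exists>B. finite B \<and> (\<forall>x\<in>orthocomp B. q x \<le> c * (norm x)\<^sup>2)" if c: "c > \<beta>" for c
  proof -
    obtain d where "d \<in> C" "d < c"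
      using cInf_lessD[OF \<open>C \<noteq> {}\<close>] c unfolding \<beta>_def by blast
    then show ?thesis
      unfolding C_def by (fastforce intro: order_trans mult_right_mono)
  qed
  have below: "\<exists>x\<in>orthocomp B. norm x = 1 \<and> c < q x" if "c < \<beta>" "finite B" for c B
  proof (rule ccontr)
    assume "\<not> ?thesis"
    then have "q x \<le> c * (norm x)\<^sup>2" if "x \<in> orthocomp B" for x
      unfolding q_def
      by (intro norm_image_sq_le[OF lin csubspace_orthocomp _ that]) (auto simp: q_def not_less)
    then have "c \<in> C"
      using \<open>finite B\<close> unfolding C_def by blast
    then have "\<beta> \<le> c"
      unfolding \<beta>_def by (rule cInf_lower[OF _ bdd])
    with \<open>c < \<beta>\<close> show False by simp
  qed
  have "\<exists>B. finite B \<and> (\<forall>x\<in>orthocomp B. \<beta> * (norm x)\<^sup>2 \<le> q x)"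
  proof (rule ccontr)
    assume neg: "\<not> ?thesis"
    have low: "\<exists>x\<in>orthocomp B. norm x = 1 \<and> q x < \<beta>" if fin: "finite B" for B
    proof -
      obtain x where x: "x \<in> orthocomp B" "q x < \<beta> * (norm x)\<^sup>2"
        using neg fin by (meson not_le)
      have "x \<noteq> 0"
        using x(2) by (auto simp: q_def)
      then have "q (sgn x) < \<beta>"
        using x(2) by (simp add: q_def norm_image_sgn_sq[OF lin] field_simps)
      with \<open>x \<noteq> 0\<close> show ?thesis
        by (intro bexI[of _ "sgn x"] sgn_in_csubspace csubspace_orthocomp x(1)) (simp add: norm_sgn)
    qed
    have step: "\<exists>z\<in>orthocomp B. norm z = 1 \<and> c < q z \<and> q z < \<beta>" if fin: "finite B" and c: "c < \<beta>" for B c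
    proof -
      obtain x where x: "x \<in> orthocomp B" "norm x = 1" "q x < \<beta>"
        using low[OF \<open>finite B\<close>] by blast
      \<comment> \<open>Orthogonality to both \<open>x\<close> and \<open>T (T x)\<close> makes
        \<open>x\<close> and \<open>y\<close> orthogonal for the inner product and for the form, so
        \<open>q\<close> interpolates between its values at \<open>x\<close> and
        \<open>y\<close>.\<close>
      obtain y where y: "y \<in> orthocomp (insert x (insert (T (T x)) B))" "norm y = 1" "max c (q x) < q y"
        using below[of "max c (q x)" "insert x (insert (T (T x)) B)"] x(3) fin c
        unfolding max_less_iff_conj by blast
      have yB: "y \<in> orthocomp B" and xy: "cinner x y = 0" and Txy: "cinner (T x) (T y) = 0"
        using y(1) by (auto simp: orthocomp_insert is_adjointD[OF T(2)])
      consider "c < q x" | "q y < \<beta>" | "q x \<le> c" "\<beta> \<le> q y" by linarith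
      then show ?thesis
      proof cases
        case 1
        with x show ?thesis by blast
      next
        case 2
        with y(2,3) yB show ?thesis by auto
      next
        case 3
        define m where "m = (c + \<beta>) / 2"
        \<comment> \<open>The unit vector with squared weights \<open>1 - \<theta>\<close> on
          \<open>x\<close> and \<theta> on \<open>y\<close> has form value
          \<open>q x + \<theta> * (q y - q x)\<close>; this choice makes it
          \<open>m\<close>.\<close>
        define \<theta> where "\<theta> = (m - q x) / (q y - q x)"
        have m: "c < m" "m < \<beta>"
          using \<open>c < \<beta>\<close> by (simp_all add: m_def)
        have \<theta>: "0 \<le> \<theta>" "\<theta> \<le> 1"
          using 3 m by (auto simp: \<theta>_def divide_simps)
        define u where "u = sqrt (1 - \<theta>) *\<^sub>R x"
        define v where "v = sqrt \<theta> *\<^sub>R y"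
        have "(norm (u + v))\<^sup>2 = (norm u)\<^sup>2 + (norm v)\<^sup>2"
          by (intro norm_add_sq_orthogonal)
            (simp add: u_def v_def cinner.scaleR_left cinner.scaleR_right xy)
        also have "\<dots> = 1"
          using \<theta> by (simp add: u_def v_def x(2) y(2) power_mult_distrib)
        finally have "norm (u + v) = 1"
          by (simp add: power2_eq_1_iff) (smt (verit) norm_ge_zero)
        have "q (u + v) = (norm (T u))\<^sup>2 + (norm (T v))\<^sup>2"
          unfolding q_def bounded_clinear_add[OF bcl]
          by (intro norm_add_sq_orthogonal)
            (simp add: u_def v_def linear_scale[OF bounded_linear.linear[OF lin]]
              cinner.scaleR_left cinner.scaleR_right Txy)
        also have "\<dots> = (1 - \<theta>) * q x + \<theta> * q y"
          using \<theta> by (simp add: u_def v_def q_def linear_scale[OF bounded_linear.linear[OF lin]]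
              power_mult_distrib)
        also have "\<dots> = q x + \<theta> * (q y - q x)"
          by algebra
        also have "\<dots> = m"
          using 3 m by (simp add: \<theta>_def)
        finally have "q (u + v) = m" .
        moreover have "u + v \<in> orthocomp B"
          unfolding u_def v_def
          by (intro csubspace_add csubspace_scaleR csubspace_orthocomp x(1) yB)
        ultimately show ?thesis
          using m \<open>norm (u + v) = 1\<close> by blast
      qed
    qed
    \<comment> \<open>A state of the recursion consists of the finite set \<open>Z\<close> of
      earlier constraints and the current vector \<open>z\<close>. Each transition adds
      \<open>z\<close> and \<open>T (T z)\<close> to the constraints, which ensures both kinds of
      orthogonality.\<close>
    define P where "P = (\<lambda>(n::nat) (Z :: 'a set, z :: 'a). finite Z \<and> norm z = 1 \<and> q z < \<beta>)"
    define Q where "Q = (\<lambda>(n::nat) (Z, z) (Z', z'). Z' = insert z (insert (T (T z)) Z) \<and>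
      z' \<in> orthocomp Z' \<and> q z < q z')"
    have "\<exists>f. \<forall>n. P n (f n) \<and> Q n (f n) (f (Suc n))"
    proof (rule dependent_nat_choice)
      show "\<exists>f. P 0 f"
        using low[of "{}"] by (auto simp: P_def)
    next
      fix f n assume "P n f"
      then have f: "finite (fst f)" "q (snd f) < \<beta>"
        by (auto simp: P_def)
      define Z where "Z = insert (snd f) (insert (T (T (snd f))) (fst f))"
      obtain z where "z \<in> orthocomp Z" "norm z = 1" "q (snd f) < q z" "q z < \<beta>"
        using step[of Z "q (snd f)"] f by (auto simp: Z_def)
      with f show "\<exists>g. P (Suc n) g \<and> Q n f g"
        by (intro exI[of _ "(Z, z)"]) (auto simp: P_def Q_def Z_def split: prod.splits)
    qed
    then obtain f where f: "\<And>n. P n (f n)" "\<And>n. Q n (f n) (f (Suc n))"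
      by blast
    define Z where "Z n = fst (f n)" for n
    define z where "z n = snd (f n)" for n
    have z: "norm (z n) = 1" "q (z n) < q (z (Suc n))" for n
      using f(1,2)[of n] by (auto simp: P_def Q_def z_def split: prod.splits)
    have Z: "Z (Suc n) = insert (z n) (insert (T (T (z n))) (Z n))" "z (Suc n) \<in> orthocomp (Z (Suc n))" for n
      using f(2)[of n] by (auto simp: Q_def z_def Z_def split: prod.splits)
    have ZM: "z i \<in> Z j \<and> T (T (z i)) \<in> Z j" if "i < j" for i j
      using that by (induction j) (auto simp: Z less_Suc_eq)
    have lt: "cinner (z i) (z j) = 0" "cinner (z i) (T (T (z j))) = 0" if "i < j" for i j
    proof -
      \<comment> \<open>The constraint is recorded only at successor indices; \<open>i < j\<close>
        makes \<open>j\<close> one.\<close>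
      have "z j \<in> orthocomp (Z j)"
        using Z(2)[of "j - 1"] that by simp
      then show "cinner (z i) (z j) = 0" "cinner (z i) (T (T (z j))) = 0"
        using ZM[OF that] orthocompD(1)[of "z j" "Z j"] by (auto simp: is_adjointD[OF T(2), symmetric])
    qed
    have "cinner (z i) (z j) = 0" "cinner (z i) (T (T (z j))) = 0" if "i \<noteq> j" for i j
      using lt[of i j] lt[of j i] that cinner_zero_commute[of "z i" "z j"]
        cinner_zero_commute[of "T (T (z i))" "z j"]
      by (cases i j rule: linorder_cases; simp add: is_adjointD[OF T(2)])+
    with AN_no_increasing_sequence[OF T, of z] z show False
      by (auto simp: q_def)
  qed
  with \<open>\<beta> \<ge> 0\<close> above that show thesis
    unfolding q_def by blast
qed

section \<open>Permanence of finite smallness and its derivation from forms\<close>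

text \<open>The adjoint \<open>J'\<close> carries the finite set \<open>B\<close> back: a vector
  orthogonal to its image is mapped by \<open>J\<close> into \<open>orthocomp B\<close>. Applied to
  embeddings of summands, this handles the entries of a block operator.\<close>

lemma finitely_small_pullback:
  assumes "finitely_small R" "is_adjoint J' J" "\<And>x. norm (J x) \<le> norm x"
    and "c > 0" "\<And>x. norm (Y x) \<le> c * norm (R (J x))"
  shows "finitely_small Y"
  unfolding finitely_small_def
proof (intro allI impI)
  fix \<epsilon> :: real assume "\<epsilon> > 0"
  then have "\<epsilon> / c > 0" using \<open>c > 0\<close> by simp
  then obtain B where B: "finite B" "\<And>x. x \<in> orthocomp B \<Longrightarrow> norm (R x) \<le> \<epsilon> / c * norm x"
    using finitely_smallE[OF assms(1)] by metis
  have "norm (Y x) \<le> \<epsilon> * norm x" if "x \<in> orthocomp (J' ` B)" for x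
  proof -
    have "J x \<in> orthocomp B"
      using that by (simp add: orthocomp_def is_adjointD[OF assms(2)])
    then have "norm (R (J x)) \<le> \<epsilon> / c * norm x"
      using B(2)[of "J x"] mult_left_mono[OF assms(3)[of x], of "\<epsilon> / c"] \<open>\<epsilon> / c > 0\<close> by linarith
    then have "c * norm (R (J x)) \<le> \<epsilon> * norm x"
      using \<open>c > 0\<close> by (simp add: field_simps)
    with assms(5)[of x] show ?thesis by linarith
  qed
  with B(1) show "\<exists>B. finite B \<and> (\<forall>x\<in>orthocomp B. norm (Y x) \<le> \<epsilon> * norm x)"
    by (intro exI[of _ "J' ` B"]) simp
qed

lemma finitely_small_mono:
  assumes "finitely_small R" "c > 0" "\<And>x. norm (Y x) \<le> c * norm (R x)"
  shows "finitely_small Y"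
  by (rule finitely_small_pullback[where J = "\<lambda>x. x" and J' = "\<lambda>x. x"])
    (use assms in \<open>auto simp: is_adjoint_def\<close>)

lemma finitely_small_add:
  assumes "finitely_small R" "finitely_small S"
  shows "finitely_small (\<lambda>x. R x + S x)"
  unfolding finitely_small_def
proof (intro allI impI)
  fix \<epsilon> :: real assume "\<epsilon> > 0"
  then have \<epsilon>: "\<epsilon> / 2 > 0" by simp
  obtain B where B: "finite B" "\<And>x. x \<in> orthocomp B \<Longrightarrow> norm (R x) \<le> \<epsilon> / 2 * norm x"
    using finitely_smallE[OF assms(1) \<epsilon>] by metis
  obtain C where C: "finite C" "\<And>x. x \<in> orthocomp C \<Longrightarrow> norm (S x) \<le> \<epsilon> / 2 * norm x"
    using finitely_smallE[OF assms(2) \<epsilon>] by metis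
  have "norm (R x + S x) \<le> \<epsilon> * norm x" if "x \<in> orthocomp (B \<union> C)" for x
    using norm_triangle_ineq[of "R x" "S x"] B(2)[of x] C(2)[of x] that
    by (simp add: orthocomp_Un)
  with B(1) C(1) show "\<exists>B. finite B \<and> (\<forall>x\<in>orthocomp B. norm (R x + S x) \<le> \<epsilon> * norm x)"
    by (intro exI[of _ "B \<union> C"]) simp
qed

text \<open>Polarization expresses \<open>Re (cinner y (K x))\<close> by the form at
  \<open>x + y\<close> and \<open>x - y\<close>; the first value is small and the second is
  nonnegative. Taking \<open>y\<close> along \<open>K x\<close> turns this into a bound on
  \<open>norm (K x)\<close>.\<close>

lemma finitely_small_of_form:
  assumes K: "bounded_clinear K" "is_adjoint K K"
    and nonneg: "finite B" "\<And>x. x \<in> orthocomp B \<Longrightarrow> Re (cinner x (K x)) \<ge> 0"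
    and small: "\<And>\<epsilon>. \<epsilon> > 0 \<Longrightarrow> \<exists>C. finite C \<and> (\<forall>x\<in>orthocomp C. Re (cinner x (K x)) \<le> \<epsilon> * (norm x)\<^sup>2)"
  shows "finitely_small K"
  unfolding finitely_small_def
proof (intro allI impI)
  fix \<epsilon> :: real assume "\<epsilon> > 0"
  then obtain C where C: "finite C" "\<And>x. x \<in> orthocomp C \<Longrightarrow> Re (cinner x (K x)) \<le> \<epsilon> * (norm x)\<^sup>2"
    using small[of \<epsilon>] by auto
  let ?D = "B \<union> C"
  \<comment> \<open>Orthogonality to the image of \<open>?D\<close> under \<open>K\<close> puts
    \<open>K x\<close> in \<open>orthocomp ?D\<close> as well, so both form bounds apply to
    combinations of \<open>x\<close> and \<open>K x\<close>.\<close>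
  have "norm (K x) \<le> \<epsilon> * norm x" if x: "x \<in> orthocomp (?D \<union> K ` ?D)" for x
  proof (cases "x = 0 \<or> K x = 0")
    case True
    then show ?thesis
      using \<open>\<epsilon> > 0\<close> linear_0[OF bounded_linear.linear[OF bounded_clinear_bounded_linear[OF K(1)]]] by auto
  next
    case False
    have xD: "x \<in> orthocomp ?D"
      using x by (simp add: orthocomp_Un)
    have KxD: "K x \<in> orthocomp ?D"
      using x by (auto simp: orthocomp_def is_adjointD[OF K(2), symmetric])
    \<comment> \<open>This scaling gives \<open>y\<close> the norm of \<open>x\<close>, which
      balances the two sides of the polarization estimate.\<close>
    define t where "t = norm x / norm (K x)"
    define y where "y = t *\<^sub>R K x"
    have "t > 0" using False by (simp add: t_def)
    have yD: "y \<in> orthocomp ?D"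
      unfolding y_def by (intro csubspace_scaleR csubspace_orthocomp KxD)
    have ny: "norm y = norm x"
      using False by (simp add: y_def t_def)
    have "4 * Re (cinner y (K x)) = Re (cinner (x + y) (K (x + y))) - Re (cinner (x - y) (K (x - y)))"
    proof -
      have "Re (cinner x (K y)) = Re (cinner y (K x))"
        using is_adjointD[OF K(2), of x y] Re_cinner_commute[of "K x" y] by simp
      then show ?thesis
        by (simp add: cinner.add_left cinner.add_right cinner.diff_left cinner.diff_right
            linear_add linear_diff bounded_linear.linear[OF bounded_clinear_bounded_linear[OF K(1)]])
    qed
    also have "Re (cinner (x - y) (K (x - y))) \<ge> 0"
      using csubspace_diff[OF csubspace_orthocomp xD yD] by (intro nonneg) (simp add: orthocomp_Un)
    then have "Re (cinner (x + y) (K (x + y))) - Re (cinner (x - y) (K (x - y)))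
        \<le> Re (cinner (x + y) (K (x + y)))" by simp
    also have "\<dots> \<le> \<epsilon> * (norm (x + y))\<^sup>2"
      using csubspace_add[OF csubspace_orthocomp xD yD] by (intro C) (simp add: orthocomp_Un)
    also have "\<dots> \<le> \<epsilon> * (2 * norm x)\<^sup>2"
      using norm_triangle_ineq[of x y] ny \<open>\<epsilon> > 0\<close> by (intro mult_left_mono power_mono) auto
    finally have "Re (cinner y (K x)) \<le> \<epsilon> * (norm x)\<^sup>2"
      by (simp add: power_mult_distrib)
    moreover have "Re (cinner y (K x)) = norm x * norm (K x)"
      using False by (simp add: y_def t_def cinner.scaleR_left cinner_same power2_eq_square)
    ultimately show ?thesis
      using False by (simp add: power2_eq_square)
  qed
  with nonneg(1) C(1) show "\<exists>B. finite B \<and> (\<forall>x\<in>orthocomp B. norm (K x) \<le> \<epsilon> * norm x)"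
    by (intro exI[of _ "?D \<union> K ` ?D"]) simp
qed

lemma is_adjoint_shift:
  assumes "is_adjoint A A"
  shows "is_adjoint (\<lambda>x. A x - complex_of_real r *\<^sub>C x) (\<lambda>x. A x - complex_of_real r *\<^sub>C x)"
  using assms
  by (simp add: is_adjoint_def cinner.diff_left cinner.diff_right cinner_scaleC_left cinner_scaleC_right)

lemma is_adjoint_square: "is_adjoint A A \<Longrightarrow> is_adjoint (\<lambda>x. A (A x)) (\<lambda>x. A (A x))"
  by (simp add: is_adjoint_def)

text \<open>The form bounds make \<open>T\<^sup>2 - \<beta>\<close> finitely small. For \<alpha> > 0
  the factor \<open>T + \<alpha>\<close> is bounded below by \<alpha>, so smallness passes to
  \<open>T - \<alpha>\<close>; for \<alpha> = 0 the upper form bounds already bound \<open>T\<close>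
  itself.\<close>

lemma positive_AN_finitely_small:
  fixes T :: "'a::{complex_inner, complete_space} \<Rightarrow> 'a"
  assumes T: "AN T" "positive_op T" and inf: "\<not> finite_dim_set (UNIV :: 'a set)"
  obtains \<alpha> B where "\<alpha> \<ge> 0" "finitely_small (\<lambda>x. T x - complex_of_real \<alpha> *\<^sub>C x)"
    and "finite B" "\<And>x. x \<in> orthocomp B \<Longrightarrow> \<alpha>\<^sup>2 * (norm x)\<^sup>2 \<le> (norm (T x))\<^sup>2"
proof -
  note sa = positive_op_selfadjoint[OF T(2)]
  note bcl = positive_op_bounded_clinear[OF T(2)]
  obtain \<beta> B where \<beta>: "\<beta> \<ge> 0"
    "\<And>c. c > \<beta> \<Longrightarrow> \<exists>B. finite B \<and> (\<forall>x\<in>orthocomp B. (norm (T x))\<^sup>2 \<le> c * (norm x)\<^sup>2)"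
    and B: "finite B" "\<And>x. x \<in> orthocomp B \<Longrightarrow> \<beta> * (norm x)\<^sup>2 \<le> (norm (T x))\<^sup>2"
    using AN_quadratic_form_bounds[OF T(1) sa inf] by (metis (no_types, lifting))
  define \<alpha> where "\<alpha> = sqrt \<beta>"
  have \<alpha>: "\<alpha> \<ge> 0" "\<alpha>\<^sup>2 = \<beta>"
    using \<beta>(1) by (simp_all add: \<alpha>_def)
  define K where "K x = T (T x) - complex_of_real \<beta> *\<^sub>C x" for x
  have form: "Re (cinner x (K x)) = (norm (T x))\<^sup>2 - \<beta> * (norm x)\<^sup>2" for x
    by (simp add: K_def cinner.diff_right cinner_scaleC_right norm_sq_selfadjoint[OF sa] cinner_same)
  have "finitely_small K"
  proof (rule finitely_small_of_form)
    show "bounded_clinear K"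
      unfolding K_def [abs_def] by (rule bounded_clinear_shift[OF bounded_clinear_compose[OF bcl bcl]])
    show "is_adjoint K K"
      unfolding K_def [abs_def] by (intro is_adjoint_shift is_adjoint_square sa)
    show "finite B" by (rule B)
    show "Re (cinner x (K x)) \<ge> 0" if "x \<in> orthocomp B" for x
      using B(2)[OF that] by (simp add: form)
    show "\<exists>C. finite C \<and> (\<forall>x\<in>orthocomp C. Re (cinner x (K x)) \<le> \<epsilon> * (norm x)\<^sup>2)" if "\<epsilon> > 0" for \<epsilon>
      using \<beta>(2)[of "\<beta> + \<epsilon>"] that by (simp add: form algebra_simps)
  qed
  define R where "R x = T x - complex_of_real \<alpha> *\<^sub>C x" for x
  have K_R: "K x = T (R x) + complex_of_real \<alpha> *\<^sub>C R x" for x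
    by (simp add: K_def R_def bounded_clinear_scaleC[OF bcl] scaleC.diff_right scaleC_scaleC
        linear_diff[OF bounded_linear.linear[OF bounded_clinear_bounded_linear[OF bcl]]]
        power2_eq_square flip: \<alpha>(2))
  have "finitely_small R"
  proof (cases "\<alpha> = 0")
    case True
    show ?thesis
      unfolding finitely_small_def
    proof (intro allI impI)
      fix \<epsilon> :: real assume "\<epsilon> > 0"
      then obtain C where C: "finite C" "\<And>x. x \<in> orthocomp C \<Longrightarrow> (norm (T x))\<^sup>2 \<le> \<epsilon>\<^sup>2 * (norm x)\<^sup>2"
        using \<beta>(2)[of "\<epsilon>\<^sup>2"] True \<alpha>(2) by auto
      have "norm (T x) \<le> \<epsilon> * norm x" if "x \<in> orthocomp C" for x
        by (rule power2_le_imp_le) (use C(2)[OF that] \<open>\<epsilon> > 0\<close> in \<open>simp_all add: power_mult_distrib\<close>)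
      with C(1) show "\<exists>B. finite B \<and> (\<forall>x\<in>orthocomp B. norm (R x) \<le> \<epsilon> * norm x)"
        unfolding R_def True by (intro exI[of _ C]) simp
    qed
  next
    case False
    with \<alpha>(1) have "\<alpha> > 0" by simp
    have "norm (R x) \<le> 1 / \<alpha> * norm (K x)" for x
    proof (cases "R x = 0")
      case False
      have "\<alpha> * (norm (R x))\<^sup>2 \<le> Re (cinner (R x) (K x))"
        using T(2) by (simp add: K_R cinner.add_right cinner_scaleC_right cinner_same positive_op_def)
      also have "\<dots> \<le> norm (R x) * norm (K x)"
        by (rule Re_cinner_le)
      finally show ?thesis
        using False \<open>\<alpha> > 0\<close> by (simp add: power2_eq_square field_simps)
    qed (use \<open>\<alpha> > 0\<close> in simp)
    with \<open>\<alpha> > 0\<close> show ?thesis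
      by (intro finitely_small_mono[OF \<open>finitely_small K\<close>, of "1 / \<alpha>" R]) simp_all
  qed
  then show thesis
    using \<alpha> B by (intro that[of \<alpha> B]) (simp_all add: R_def [abs_def])
qed

section \<open>Linear systems and maximizers of quadratic forms\<close>

text \<open>Gaussian elimination: equation \<open>b\<close> is solved for an unknown
  \<open>e0\<close> with nonzero coefficient and substituted into the others; \<open>s\<close> is
  the resulting value of \<open>e0\<close>. The lemma yields combinations of many vectors orthogonal
  to fewer given ones.\<close>

lemma homogeneous_system_nontrivial:
  fixes a :: "'b \<Rightarrow> 'e \<Rightarrow> 'f::field"
  assumes "finite B" "finite E" "card B < card E"
  shows "\<exists>t. (\<exists>e\<in>E. t e \<noteq> 0) \<and> (\<forall>b\<in>B. (\<Sum>e\<in>E. a b e * t e) = 0)"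
  using assms
proof (induction B arbitrary: a E rule: finite_induct)
  case empty
  then show ?case by (intro exI[of _ "\<lambda>_. 1"]) (auto simp: card_gt_0_iff)
next
  case (insert b B)
  show ?case
  proof (cases "\<forall>e\<in>E. a b e = 0")
    case True
    have "card B < card E"
      using insert.prems insert.hyps by simp
    with insert.IH[OF insert.prems(1), of a] True show ?thesis by auto
  next
    case False
    then obtain e0 where e0: "e0 \<in> E" "a b e0 \<noteq> 0" by blast
    define E' where "E' = E - {e0}"
    have E': "finite E'" "card B < card E'" "E = insert e0 E'" "e0 \<notin> E'"
      using insert.prems insert.hyps e0(1) by (auto simp: E'_def)
    obtain t where t: "\<exists>e\<in>E'. t e \<noteq> 0"
      "\<And>c. c \<in> B \<Longrightarrow> (\<Sum>e\<in>E'. (a c e - a c e0 * a b e / a b e0) * t e) = 0"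
      using insert.IH[OF E'(1,2), of "\<lambda>c e. a c e - a c e0 * a b e / a b e0"] by blast
    define s where "s = - (\<Sum>e\<in>E'. a b e * t e) / a b e0"
    have sum: "(\<Sum>e\<in>E. a c e * (t(e0 := s)) e) = a c e0 * s + (\<Sum>e\<in>E'. a c e * t e)" for c
    proof -
      have "(\<Sum>e\<in>E'. a c e * (t(e0 := s)) e) = (\<Sum>e\<in>E'. a c e * t e)"
        using E'(4) by (intro sum.cong) auto
      then show ?thesis
        unfolding E'(3) using E'(1,4) by simp
    qed
    have "(\<Sum>e\<in>E. a c e * (t(e0 := s)) e) = 0" if "c \<in> insert b B" for c
    proof (cases "c = b")
      case True
      then show ?thesis
        unfolding sum using e0(2) by (simp add: s_def)
    next
      case False
      with that have "c \<in> B" by simp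
      from t(2)[OF this] have "(\<Sum>e\<in>E'. a c e * t e) = a c e0 / a b e0 * (\<Sum>e\<in>E'. a b e * t e)"
        by (simp add: algebra_simps sum_subtractf sum_distrib_left)
      then show ?thesis
        unfolding sum by (simp add: s_def)
    qed
    moreover have "\<exists>e\<in>E. (t(e0 := s)) e \<noteq> 0"
      using t(1) E'(3,4) by auto
    ultimately show ?thesis by blast
  qed
qed

text \<open>The first-order condition at a minimum: at \<open>t = - a / d\<close> with large
  \<open>d\<close> the linear term outweighs the quadratic one and has a negative value.\<close>

lemma zero_if_linear_term_dominated:
  fixes a b :: real
  assumes "\<And>t. 0 \<le> 2 * t * a + t\<^sup>2 * b"
  shows "a = 0"
proof (rule ccontr)
  assume "a \<noteq> 0"
  define d where "d = \<bar>b\<bar> + 1"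
  have "d > 0" "b < 2 * d"
    by (auto simp: d_def)
  have "2 * (- a / d) * a + (- a / d)\<^sup>2 * b = a\<^sup>2 / d\<^sup>2 * (b - 2 * d)"
    using \<open>d > 0\<close> by (simp add: field_simps power2_eq_square)
  also have "\<dots> < 0"
    using \<open>a \<noteq> 0\<close> \<open>d > 0\<close> \<open>b < 2 * d\<close> by (intro mult_pos_neg) simp_all
  finally show False
    using assms[of "- a / d"] by simp
qed

text \<open>One positive value makes the supremum positive, which is what the compactness argument
  needs; a supremum equal to 0 may fail to be attained.\<close>

lemma cinner_form_max_of_pos:
  fixes K :: "'a::{complex_inner, complete_space} \<Rightarrow> 'a"
  assumes K: "bounded_clinear K" "finitely_small K"
    and M: "csubspace M" "closed M"
    and pos: "\<exists>x\<in>M. norm x = 1 \<and> Re (cinner x (K x)) > 0"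
  shows "\<exists>x\<in>M. norm x = 1 \<and> Re (cinner x (K x)) > 0 \<and>
    (\<forall>y\<in>M. norm y = 1 \<longrightarrow> Re (cinner y (K y)) \<le> Re (cinner x (K x)))"
proof -
  define V where "V = (\<lambda>x. Re (cinner x (K x))) ` {x\<in>M. norm x = 1}"
  define s where "s = Sup V"
  obtain k where k: "\<And>x. norm (K x) \<le> norm x * k"
    using bounded_linear.bounded[OF bounded_clinear_bounded_linear[OF K(1)]] by blast
  have "Re (cinner x (K x)) \<le> k" if "norm x = 1" for x
    using Re_cinner_le[of x "K x"] k[of x] that by simp
  then have bdd: "bdd_above V"
    unfolding V_def by (intro bdd_aboveI[of _ k]) auto
  have le: "Re (cinner x (K x)) \<le> s" if "x \<in> M" "norm x = 1" for x
    unfolding s_def using that by (intro cSup_upper bdd) (auto simp: V_def)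
  obtain x0 where x0: "x0 \<in> M" "norm x0 = 1" "Re (cinner x0 (K x0)) > 0"
    using pos by blast
  then have "V \<noteq> {}" by (auto simp: V_def)
  have "s > 0"
    using le[OF x0(1,2)] x0(3) by simp
  have "\<exists>x\<in>M. norm x = 1 \<and> Re (cinner x (K x)) = s"
  proof (rule cinner_form_sup_attained[OF K M \<open>s > 0\<close> le])
    fix \<epsilon> :: real assume "\<epsilon> > 0"
    then show "\<exists>x\<in>M. norm x = 1 \<and> s - \<epsilon> < Re (cinner x (K x))"
      using less_cSupD[OF \<open>V \<noteq> {}\<close>, of "s - \<epsilon>"] by (auto simp: V_def s_def)
  qed
  with le \<open>s > 0\<close> show ?thesis by metis
qed

text \<open>With \<open>s\<close> the maximum, the form \<open>h\<close> is nonnegative on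
  \<open>M\<close> and vanishes at \<open>x\<close>. Its first variation at \<open>x\<close> in the
  direction \<open>y = s *\<^sub>R x - K x\<close> is a multiple of \<open>(norm y)\<^sup>2\<close>,
  so \<open>y = 0\<close>.\<close>

lemma eigenvector_of_form_max:
  assumes K: "bounded_clinear K" "is_adjoint K K"
    and M: "csubspace M" "\<And>x. x \<in> M \<Longrightarrow> K x \<in> M"
    and x: "x \<in> M" "norm x = 1"
    and max: "\<And>y. y \<in> M \<Longrightarrow> norm y = 1 \<Longrightarrow> Re (cinner y (K y)) \<le> Re (cinner x (K x))"
  shows "K x = Re (cinner x (K x)) *\<^sub>R x"
proof -
  define s where "s = Re (cinner x (K x))"
  note lin = bounded_clinear_bounded_linear[OF K(1)]
  define h where "h v = s * (norm v)\<^sup>2 - Re (cinner v (K v))" for v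
  define y where "y = s *\<^sub>R x - K x"
  have yM: "y \<in> M"
    unfolding y_def by (intro csubspace_diff csubspace_scaleR M x)
  have "0 \<le> 2 * t * (norm y)\<^sup>2 + t\<^sup>2 * h y" for t
  proof -
    have "x + t *\<^sub>R y \<in> M"
      by (intro csubspace_add csubspace_scaleR M(1) x(1) yM)
    then have "0 \<le> h (x + t *\<^sub>R y)"
      unfolding h_def using cinner_form_le[OF lin M(1), of s] max by (simp add: s_def)
    also have "h (x + t *\<^sub>R y) = h x + 2 * t * (s * Re (cinner y x) - Re (cinner y (K x))) + t\<^sup>2 * h y"
    proof -
      have "Re (cinner x (K y)) = Re (cinner y (K x))"
        using is_adjointD[OF K(2), of x y] Re_cinner_commute[of "K x" y] by simp
      then have "Re (cinner (x + t *\<^sub>R y) (K (x + t *\<^sub>R y))) =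
          Re (cinner x (K x)) + 2 * t * Re (cinner y (K x)) + t\<^sup>2 * Re (cinner y (K y))"
        by (simp add: cinner.add_left cinner.add_right cinner.scaleR_left cinner.scaleR_right
            linear_add linear_scale bounded_linear.linear[OF lin] algebra_simps power2_eq_square)
      moreover have "(norm (x + t *\<^sub>R y))\<^sup>2 = (norm x)\<^sup>2 + 2 * t * Re (cinner y x) + t\<^sup>2 * (norm y)\<^sup>2"
        by (simp add: norm_add_sq cinner.scaleR_right power_mult_distrib Re_cinner_commute[of x y])
      ultimately show ?thesis
        by (simp add: h_def algebra_simps)
    qed
    also have "s * Re (cinner y x) - Re (cinner y (K x)) = Re (cinner y y)"
      by (subst (4) y_def) (simp add: cinner.diff_right cinner.scaleR_right)
    also have "h x = 0"
      by (simp add: h_def s_def x(2))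
    finally show ?thesis
      by (simp add: Re_cinner_same)
  qed
  then have "(norm y)\<^sup>2 = 0"
    by (rule zero_if_linear_term_dominated)
  then show ?thesis
    by (simp add: y_def s_def)
qed

section \<open>Compact perturbations of a scalar\<close>

text \<open>Negative eigenvectors of \<open>T - \<alpha>\<close> are eigenvectors of \<open>T\<close> with eigenvalue in \<open>[0, \<alpha>)\<close>, and
  \<open>|T x| < \<alpha> |x|\<close> on their span, which therefore meets \<open>orthocomp B\<close> only in \<open>0\<close>. Hence there are
  at most \<open>card B\<close> orthonormal ones, and a maximal such system \<open>E\<close> works because a negative value
  of the form on the invariant subspace \<open>orthocomp E\<close> would produce another one.\<close>

lemma finitely_many_negative_directions:
  fixes T :: "'a::{complex_inner, complete_space} \<Rightarrow> 'a"
  assumes T: "positive_op T"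
    and small: "finitely_small (\<lambda>x. T x - complex_of_real \<alpha> *\<^sub>C x)"
    and B: "finite B" "\<And>x. x \<in> orthocomp B \<Longrightarrow> \<alpha>\<^sup>2 * (norm x)\<^sup>2 \<le> (norm (T x))\<^sup>2"
  obtains E where "finite E" "\<And>x. x \<in> orthocomp E \<Longrightarrow> \<alpha> * (norm x)\<^sup>2 \<le> Re (cinner x (T x))"
proof -
  note bcl = positive_op_bounded_clinear[OF T]
  note sa = positive_op_selfadjoint[OF T]
  define P where "P E \<longleftrightarrow> finite E \<and> orthonormal E \<and> (\<forall>e\<in>E. \<exists>m<\<alpha>. T e = m *\<^sub>R e)" for E
  have card_le: "card E \<le> card B" if "P E" for E
  proof (rule ccontr)
    assume "\<not> card E \<le> card B"
    have E: "finite E" "orthonormal E" "\<And>e. e \<in> E \<Longrightarrow> \<exists>m<\<alpha>. T e = m *\<^sub>R e"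
      using \<open>P E\<close> by (auto simp: P_def)
    \<comment> \<open>More vectors in \<open>E\<close> than in \<open>B\<close> leave a nontrivial
      combination of \<open>E\<close> orthogonal to \<open>B\<close>.\<close>
    obtain t where t: "\<exists>e\<in>E. t e \<noteq> 0" "\<forall>b\<in>B. (\<Sum>e\<in>E. cinner b e * t e) = 0"
      using homogeneous_system_nontrivial[OF B(1) E(1), of cinner] \<open>\<not> card E \<le> card B\<close> by auto
    define x where "x = (\<Sum>e\<in>E. t e *\<^sub>C e)"
    have "x \<in> orthocomp B"
      using t(2) by (simp add: orthocomp_def x_def cinner.sum_right cinner_scaleC_right mult.commute)
    have Te: "(norm (T e))\<^sup>2 < \<alpha>\<^sup>2" if e: "e \<in> E" for e
    proof -
      obtain m where m: "m < \<alpha>" "T e = m *\<^sub>R e"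
        using E(3)[OF e] by blast
      have "norm e = 1"
        using E(2) e by (simp add: orthonormal_def)
      have "0 \<le> Re (cinner e (T e))"
        using T by (simp add: positive_op_def)
      then have "0 \<le> m"
        by (simp add: m(2) cinner.scaleR_right cinner_same \<open>norm e = 1\<close>)
      then show ?thesis
        using m \<open>norm e = 1\<close> by (simp add: power_strict_mono)
    qed
    have orth: "cinner e f = 0" "cinner (T e) (T f) = 0" if "e \<in> E" "f \<in> E" "e \<noteq> f" for e f
    proof -
      show "cinner e f = 0"
        using E(2) that by (simp add: orthonormal_def)
      then show "cinner (T e) (T f) = 0"
        using E(3)[OF that(1)] E(3)[OF that(2)]
        by (auto simp: cinner.scaleR_left cinner.scaleR_right)
    qed
    have "(norm x)\<^sup>2 = (\<Sum>e\<in>E. (norm (t e *\<^sub>C e))\<^sup>2)"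
      unfolding x_def
      by (intro norm_sum_sq_orthogonal E(1)) (simp add: cinner_scaleC_left cinner_scaleC_right orth)
    also have "\<dots> = (\<Sum>e\<in>E. (cmod (t e))\<^sup>2)"
      using E(2) by (intro sum.cong) (auto simp: norm_scaleC orthonormal_def)
    finally have nx: "(norm x)\<^sup>2 = (\<Sum>e\<in>E. (cmod (t e))\<^sup>2)" .
    have "(norm (T x))\<^sup>2 = (\<Sum>e\<in>E. (norm (t e *\<^sub>C T e))\<^sup>2)"
      unfolding x_def bounded_clinear_sum_scaleC[OF bcl]
      by (intro norm_sum_sq_orthogonal E(1)) (simp add: cinner_scaleC_left cinner_scaleC_right orth)
    also have "\<dots> = (\<Sum>e\<in>E. (cmod (t e))\<^sup>2 * (norm (T e))\<^sup>2)"
      by (simp add: norm_scaleC power_mult_distrib)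
    also have "\<dots> < (\<Sum>e\<in>E. (cmod (t e))\<^sup>2 * \<alpha>\<^sup>2)"
    proof (rule sum_strict_mono_ex1[OF E(1)])
      show "\<forall>e\<in>E. (cmod (t e))\<^sup>2 * (norm (T e))\<^sup>2 \<le> (cmod (t e))\<^sup>2 * \<alpha>\<^sup>2"
        by (intro ballI mult_left_mono less_imp_le[OF Te]) simp_all
      show "\<exists>e\<in>E. (cmod (t e))\<^sup>2 * (norm (T e))\<^sup>2 < (cmod (t e))\<^sup>2 * \<alpha>\<^sup>2"
      proof -
        obtain e where "e \<in> E" "t e \<noteq> 0"
          using t(1) by blast
        then show ?thesis
          by (intro bexI[of _ e] mult_strict_left_mono Te) simp_all
      qed
    qed
    also have "\<dots> = \<alpha>\<^sup>2 * (norm x)\<^sup>2"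
      by (simp add: nx sum_distrib_left mult.commute)
    finally show False
      using B(2)[OF \<open>x \<in> orthocomp B\<close>] by simp
  qed
  have "P {}" by (simp add: P_def)
  moreover have "\<forall>E. P E \<longrightarrow> card E < Suc (card B)"
    using card_le by (simp add: less_Suc_eq_le)
  ultimately obtain E where E: "P E" and E_max: "\<And>F. P F \<Longrightarrow> card F \<le> card E"
    using ex_has_greatest_nat[of P "{}" card "Suc (card B)"] by blast
  define M where "M = orthocomp E"
  have M: "csubspace M" "closed M"
    by (simp_all add: M_def csubspace_orthocomp closed_orthocomp)
  \<comment> \<open>The sign is reversed so that negative directions of \<open>T - \<alpha>\<close>
    become positive values of a form, to which the maximum principle applies.\<close>
  define K where "K x = complex_of_real \<alpha> *\<^sub>C x - T x" for x
  have "Re (cinner x (K x)) \<le> 0 * (norm x)\<^sup>2" if "x \<in> M" for x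
  proof (rule ccontr)
    have K_eq: "K = (\<lambda>x. (-1) *\<^sub>C (T x - complex_of_real \<alpha> *\<^sub>C x))"
    proof
      show "K y = (-1) *\<^sub>C (T y - complex_of_real \<alpha> *\<^sub>C y)" for y
        using scaleR_scaleC[of "-1" "T y - complex_of_real \<alpha> *\<^sub>C y"] by (simp add: K_def)
    qed
    have K: "bounded_clinear K"
      unfolding K_eq
      by (intro bounded_clinearI bounded_linear_compose[OF scaleC.bounded_linear_right]
          bounded_clinear_bounded_linear[OF bounded_clinear_shift[OF bcl]])
        (simp add: bounded_clinear_scaleC[OF bcl] scaleC.diff_right scaleC_scaleC mult.commute)
    have K_sa: "is_adjoint K K"
      using sa by (simp add: is_adjoint_def K_def cinner.diff_left cinner.diff_right
          cinner_scaleC_left cinner_scaleC_right)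
    have "finitely_small K"
      unfolding K_eq by (rule finitely_small_mono[OF small, of 1]) (simp_all add: norm_scaleC)
    assume "\<not> ?thesis"
    then have "\<exists>x\<in>M. norm x = 1 \<and> Re (cinner x (K x)) > 0"
      using cinner_form_le[OF bounded_clinear_bounded_linear[OF K] M(1) _ \<open>x \<in> M\<close>, of 0] by force
    then obtain v where v: "v \<in> M" "norm v = 1" "Re (cinner v (K v)) > 0"
      and v_max: "\<And>y. y \<in> M \<Longrightarrow> norm y = 1 \<Longrightarrow> Re (cinner y (K y)) \<le> Re (cinner v (K v))"
      using cinner_form_max_of_pos[OF K \<open>finitely_small K\<close> M] by blast
    have "K y \<in> M" if "y \<in> M" for y
      unfolding M_def orthocomp_def
    proof (intro CollectI ballI)
      fix e assume "e \<in> E"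
      then obtain m where "T e = m *\<^sub>R e"
        using E by (auto simp: P_def)
      then show "cinner e (K y) = 0"
        using orthocompD(1)[of y E e] \<open>e \<in> E\<close> that
        by (simp add: K_def M_def cinner.diff_right cinner_scaleC_right is_adjointD[OF sa, symmetric]
            cinner.scaleR_left)
    qed
    then have "K v = Re (cinner v (K v)) *\<^sub>R v"
      by (intro eigenvector_of_form_max[OF K K_sa M(1) _ v(1,2) v_max])
    then have "T v = (\<alpha> - Re (cinner v (K v))) *\<^sub>R v"
      by (simp add: K_def scaleR_scaleC scaleC.diff_left algebra_simps)
    with v(3) have "\<exists>m<\<alpha>. T v = m *\<^sub>R v"
      by (intro exI[of _ "\<alpha> - Re (cinner v (K v))"]) simp
    then have "P (insert v E)"
      using E v(1,2) by (simp add: P_def orthonormal_insert M_def)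
    moreover have "v \<notin> E"
    proof
      assume "v \<in> E"
      then have "cinner v v = 0"
        using v(1) by (simp add: M_def orthocompD)
      with v(2) show False by (simp add: cinner_same)
    qed
    ultimately show False
      using E_max[of "insert v E"] E by (simp add: P_def)
  qed
  then have "\<alpha> * (norm x)\<^sup>2 \<le> Re (cinner x (T x))" if "x \<in> orthocomp E" for x
    using that by (simp add: M_def K_def cinner.diff_right cinner_scaleC_right cinner_same)
  moreover have "finite E" using E by (simp add: P_def)
  ultimately show thesis using that by blast
qed

text \<open>A positive supremum is attained by compactness. If no value is positive, a unit vector
  of \<open>M\<close> in \<open>orthocomp B\<close> has value 0, the maximum. If \<open>M\<close>
  meets \<open>orthocomp B\<close> only in 0, it has finite dimension.\<close>

lemma cinner_form_max:
  fixes K :: "'a::{complex_inner, complete_space} \<Rightarrow> 'a"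
  assumes K: "bounded_clinear K" "finitely_small K"
    and B: "finite B" "\<And>x. x \<in> orthocomp B \<Longrightarrow> Re (cinner x (K x)) \<ge> 0"
    and M: "csubspace M" "closed M" "M \<noteq> {0}"
  shows "\<exists>x\<in>M. norm x = 1 \<and> (\<forall>y\<in>M. norm y = 1 \<longrightarrow> Re (cinner y (K y)) \<le> Re (cinner x (K x)))"
proof -
  consider "\<exists>x\<in>M. norm x = 1 \<and> Re (cinner x (K x)) > 0"
    | "\<forall>x\<in>M. norm x = 1 \<longrightarrow> Re (cinner x (K x)) \<le> 0" "\<not> M \<inter> orthocomp B \<subseteq> {0}"
    | "M \<inter> orthocomp B \<subseteq> {0}"
    by force
  then show ?thesis
  proof cases
    case 1
    then show ?thesis
      using cinner_form_max_of_pos[OF K M(1,2)] by blast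
  next
    case 2
    then obtain x where x: "x \<in> M" "x \<in> orthocomp B" "x \<noteq> 0" by blast
    then have "sgn x \<in> M" "norm (sgn x) = 1" "Re (cinner (sgn x) (K (sgn x))) \<ge> 0"
      using B(2)[of "sgn x"] by (simp_all add: M(1) sgn_in_csubspace csubspace_orthocomp norm_sgn)
    with 2(1) show ?thesis
      by (intro bexI[of _ "sgn x"]) (auto intro: order_trans)
  next
    case 3
    \<comment> \<open>\<open>M\<close> has finite dimension; adding a multiple of the projection onto \<open>M\<close> makes the form positive.\<close>
    obtain C where "finite C" "M \<subseteq> cspan C"
      using finite_dim_of_Int_orthocomp[OF B(1) M(1) 3] unfolding finite_dim_set_def by blast
    then obtain E where E: "finite E" "orthonormal E" "M \<subseteq> cspan E"
      using ex_orthonormal_basis by metis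
    obtain k where k: "\<And>x. norm (K x) \<le> norm x * k"
      using bounded_linear.bounded[OF bounded_clinear_bounded_linear[OF K(1)]] by blast
    \<comment> \<open>This constant exceeds the bound on \<open>K\<close>, so the form of
      \<open>L\<close> is positive on the unit sphere of \<open>M\<close>. There it differs from the
      form of \<open>K\<close> by \<open>c\<close>, so the maximizers agree.\<close>
    define c where "c = \<bar>k\<bar> + 1"
    define L where "L x = K x + complex_of_real c *\<^sub>C proj E x" for x
    have L: "Re (cinner x (L x)) = Re (cinner x (K x)) + c" if "x \<in> M" "norm x = 1" for x
      using proj_eq_self[OF E(1,2), of x] E(3) that
      by (auto simp: L_def cinner.add_right cinner_scaleC_right cinner_same)
    obtain v where "v \<in> M" "v \<noteq> 0"
      using M(3) csubspace_zero[OF M(1)] by blast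
    then have "sgn v \<in> M" "norm (sgn v) = 1"
      by (simp_all add: sgn_in_csubspace M(1) norm_sgn)
    then obtain x where x: "x \<in> M" "norm x = 1"
      by blast
    have "- k \<le> Re (cinner x (K x))"
      using norm_cinner_le[of x "K x"] abs_Re_le_cmod[of "cinner x (K x)"] k[of x] x(2) by simp
    then have "Re (cinner x (L x)) > 0"
      using L[OF x] by (simp add: c_def)
    moreover have "bounded_clinear L"
      unfolding L_def [abs_def]
      by (intro bounded_clinear_add_scaleC K(1) bounded_clinear_proj)
    moreover have "finitely_small L"
      unfolding L_def [abs_def] using E(1)
      by (intro finitely_small_add K(2))
        (auto simp: finitely_small_def proj_orthocomp_eq_0 scaleC.zero_right intro!: exI[of _ E])
    ultimately have "\<exists>x\<in>M. norm x = 1 \<and> (\<forall>y\<in>M. norm y = 1 \<longrightarrow> Re (cinner y (L y)) \<le> Re (cinner x (L x)))"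
      using cinner_form_max_of_pos[of L M] M(1,2) x by blast
    then show ?thesis
      using L by auto
  qed
qed

text \<open>On unit vectors \<open>(norm (A x))\<^sup>2\<close> differs by a constant from the form
  of \<open>A\<^sup>2 - \<alpha>\<^sup>2\<close>. That operator factors through
  \<open>A - \<alpha>\<close>, hence is finitely small, and Cauchy-Schwarz makes its form
  nonnegative on \<open>orthocomp B\<close>; so its form has a maximum on every nonzero closed
  subspace.\<close>

lemma AN_of_finitely_small:
  fixes A :: "'a::{complex_inner, complete_space} \<Rightarrow> 'a"
  assumes A: "positive_op A" and \<alpha>: "\<alpha> \<ge> 0"
    and small: "finitely_small (\<lambda>x. A x - complex_of_real \<alpha> *\<^sub>C x)"
    and B: "finite B" "\<And>x. x \<in> orthocomp B \<Longrightarrow> \<alpha> * (norm x)\<^sup>2 \<le> Re (cinner x (A x))"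
  shows "AN A"
proof -
  note bcl = positive_op_bounded_clinear[OF A]
  note lin = bounded_clinear_bounded_linear[OF bcl]
  note sa = positive_op_selfadjoint[OF A]
  define R where "R x = A x - complex_of_real \<alpha> *\<^sub>C x" for x
  define K where "K x = A (A x) - complex_of_real (\<alpha>\<^sup>2) *\<^sub>C x" for x
  have form: "Re (cinner x (K x)) = (norm (A x))\<^sup>2 - \<alpha>\<^sup>2 * (norm x)\<^sup>2" for x
    unfolding K_def
    by (simp add: cinner.diff_right cinner_scaleC_right norm_sq_selfadjoint[OF sa] cinner_same
        del: of_real_power)
  have K: "bounded_clinear K"
    unfolding K_def [abs_def] by (rule bounded_clinear_shift[OF bounded_clinear_compose[OF bcl bcl]])
  have K_R: "K x = A (R x) + complex_of_real \<alpha> *\<^sub>C R x" for x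
    by (simp add: K_def R_def bounded_clinear_scaleC[OF bcl] scaleC.diff_right scaleC_scaleC
        linear_diff[OF bounded_linear.linear[OF lin]] power2_eq_square)
  obtain k where k: "k > 0" "\<And>x. norm (A x) \<le> norm x * k"
    using bounded_linear.pos_bounded[OF lin] by blast
  have "finitely_small K"
  proof (rule finitely_small_mono[OF small, of "k + \<alpha>"])
    show "k + \<alpha> > 0" using k(1) \<alpha> by simp
    show "norm (K x) \<le> (k + \<alpha>) * norm (A x - complex_of_real \<alpha> *\<^sub>C x)" for x
      using norm_triangle_ineq[of "A (R x)" "complex_of_real \<alpha> *\<^sub>C R x"] k(2)[of "R x"] \<alpha>
      unfolding K_R by (simp add: norm_scaleC algebra_simps flip: R_def)
  qed
  have nonneg: "Re (cinner x (K x)) \<ge> 0" if "x \<in> orthocomp B" for x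
  proof -
    have "\<alpha> * norm x * norm x \<le> norm (A x) * norm x"
      using B(2)[OF that] Re_cinner_le[of x "A x"] by (simp add: power2_eq_square mult_ac)
    then have "\<alpha> * norm x \<le> norm (A x)"
      using norm_ge_zero[of "A x"] by (cases "x = 0") auto
    then have "(\<alpha> * norm x)\<^sup>2 \<le> (norm (A x))\<^sup>2"
      using \<alpha> by (intro power_mono) auto
    then show ?thesis
      by (simp add: form power_mult_distrib)
  qed
  have "norm_attaining_on M A" if M: "csubspace M" "closed M" "M \<noteq> {0}" for M
  proof -
    obtain x where x: "x \<in> M" "norm x = 1"
      "\<And>y. y \<in> M \<Longrightarrow> norm y = 1 \<Longrightarrow> Re (cinner y (K y)) \<le> Re (cinner x (K x))"
      using cinner_form_max[OF K \<open>finitely_small K\<close> B(1) nonneg M] by blast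
    have "norm (A y) \<le> norm (A x)" if "y \<in> M" "norm y = 1" for y
      by (rule power2_le_imp_le) (use x(2) x(3)[OF that] that(2) in \<open>simp_all add: form\<close>)
    with x(1,2) show ?thesis
      unfolding norm_attaining_on_iff[OF lin] by blast
  qed
  with bcl show ?thesis by (simp add: AN_def)
qed

section \<open>Essential spectrum\<close>

text \<open>For \<open>v\<close> outside \<open>W\<close>, the positive distance from
  \<open>v\<close> to \<open>W\<close> controls the coefficient of \<open>v\<close>. Along a
  convergent sequence the coefficients, and then the parts in \<open>W\<close>, converge.\<close>

lemma closed_csubspace_add_line:
  fixes W :: "'a::{complex_inner, complete_space} set"
  assumes W: "csubspace W" "closed W"
  shows "closed {w + t *\<^sub>C v | w t. w \<in> W}" (is "closed ?S")
proof (cases "v \<in> W")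
  case True
  have "?S = W"
  proof (intro subset_antisym subsetI)
    show "x \<in> ?S" if "x \<in> W" for x
      using that by (intro CollectI exI[of _ x] exI[of _ 0]) simp
  qed (use True W(1) in \<open>auto intro: csubspace_add csubspace_scaleC\<close>)
  with W(2) show ?thesis by simp
next
  case False
  then obtain d where d: "d > 0" "ball v d \<subseteq> - W"
    using W(2) open_contains_ball[of "- W"] by (auto simp: open_Compl)
  have lower: "cmod t * d \<le> norm (w + t *\<^sub>C v)" if "w \<in> W" for w t
  proof (cases "t = 0")
    case False
    \<comment> \<open>After division by \<open>t\<close> the claim concerns the distance from
      \<open>v\<close> to a point of \<open>W\<close>.\<close>
    have "(- inverse t) *\<^sub>C w \<notin> ball v d"
      using d(2) csubspace_scaleC[OF W(1) that] by blast
    then have "d \<le> norm (v - (- inverse t) *\<^sub>C w)"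
      by (simp add: dist_norm)
    then have "cmod t * d \<le> norm (t *\<^sub>C (v - (- inverse t) *\<^sub>C w))"
      unfolding norm_scaleC by (rule mult_left_mono) simp
    also have "t *\<^sub>C (v - (- inverse t) *\<^sub>C w) = w + t *\<^sub>C v"
      using False by (simp add: scaleC.diff_right scaleC.add_right scaleC_scaleC scaleC.minus_left scaleC_one)
    finally show ?thesis .
  qed simp
  show ?thesis
    unfolding closed_sequential_limits
  proof (intro allI impI)
    fix x l assume "(\<forall>n. x n \<in> ?S) \<and> x \<longlonglongrightarrow> l"
    then have "\<forall>n. \<exists>w t. w \<in> W \<and> x n = w + t *\<^sub>C v" and l: "x \<longlonglongrightarrow> l"
      by blast+
    then obtain w t where wt: "\<And>n. w n \<in> W" "\<And>n. x n = w n + t n *\<^sub>C v"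
      by metis
    have "Cauchy t"
    proof (rule metric_CauchyI)
      fix e :: real assume "e > 0"
      then have "e * d > 0" using d(1) by simp
      then obtain N where N: "\<And>m n. m \<ge> N \<Longrightarrow> n \<ge> N \<Longrightarrow> dist (x m) (x n) < e * d"
        using LIMSEQ_imp_Cauchy[OF l] unfolding Cauchy_def by meson
      have "dist (t m) (t n) < e" if "m \<ge> N" "n \<ge> N" for m n
      proof -
        have "cmod (t m - t n) * d \<le> norm ((w m - w n) + (t m - t n) *\<^sub>C v)"
          by (intro lower csubspace_diff W(1) wt)
        also have "(w m - w n) + (t m - t n) *\<^sub>C v = x m - x n"
          by (simp add: wt scaleC.diff_left)
        finally have "cmod (t m - t n) * d < e * d"
          using N[OF that] by (simp add: dist_norm)
        with d(1) show ?thesis by (simp add: dist_norm)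
      qed
      then show "\<exists>N. \<forall>m\<ge>N. \<forall>n\<ge>N. dist (t m) (t n) < e" by blast
    qed
    then obtain \<tau> where "t \<longlonglongrightarrow> \<tau>"
      using Cauchy_convergent_iff convergent_def by blast
    then have "(\<lambda>n. x n - t n *\<^sub>C v) \<longlonglongrightarrow> l - \<tau> *\<^sub>C v"
      by (intro tendsto_diff l scaleC.tendsto tendsto_const)
    moreover have "x n - t n *\<^sub>C v = w n" for n
      by (simp add: wt)
    ultimately have "w \<longlonglongrightarrow> l - \<tau> *\<^sub>C v"
      by simp
    then have "l - \<tau> *\<^sub>C v \<in> W"
      using closed_sequentially[OF W(2)] wt(1) by blast
    then show "l \<in> ?S"
      by (intro CollectI exI[of _ "l - \<tau> *\<^sub>C v"] exI[of _ \<tau>]) simp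
  qed
qed

lemma csubspace_image:
  assumes "bounded_clinear G" "csubspace M"
  shows "csubspace (G ` M)"
  unfolding csubspace_def
proof (intro conjI ballI allI)
  show "0 \<in> G ` M"
    using linear_0[OF bounded_linear.linear[OF bounded_clinear_bounded_linear[OF assms(1)]]]
      csubspace_zero[OF assms(2)] by (metis imageI)
  show "x + y \<in> G ` M" if "x \<in> G ` M" "y \<in> G ` M" for x y
    using that by (auto simp: bounded_clinear_add[OF assms(1), symmetric] csubspace_add[OF assms(2)])
  show "c *\<^sub>C x \<in> G ` M" if "x \<in> G ` M" for c x
    using that by (auto simp: bounded_clinear_scaleC[OF assms(1), symmetric] csubspace_scaleC[OF assms(2)])
qed

lemma csubspace_kernel: "bounded_clinear G \<Longrightarrow> csubspace {x. G x = 0}"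
  by (simp add: csubspace_def bounded_clinear_add bounded_clinear_scaleC scaleC.zero_right
      linear_0[OF bounded_linear.linear[OF bounded_clinear_bounded_linear]])

text \<open>The vectors of \<open>E\<close> are returned to the domain one at a time; each enlarges
  the image by at most a line, which preserves closedness.\<close>

lemma closed_range_if_closed_orthocomp_image:
  fixes G :: "'a::complex_inner \<Rightarrow> 'b::{complex_inner, complete_space}"
  assumes G: "bounded_clinear G"
    and "finite E" "orthonormal E" "closed (G ` orthocomp E)"
  shows "closed (range G)"
  using assms(2-4)
proof (induction E rule: finite_induct)
  case (insert e E)
  have e: "norm e = 1" "\<And>f. f \<in> E \<Longrightarrow> cinner f e = 0" and E: "orthonormal E"
    using insert.prems insert.hyps by (auto simp: orthonormal_def)
  let ?S = "{w + t *\<^sub>C G e | w t. w \<in> G ` orthocomp (insert e E)}"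
  have "G ` orthocomp E = ?S"
  proof (intro subset_antisym subsetI)
    fix y assume "y \<in> G ` orthocomp E"
    then obtain x where x: "x \<in> orthocomp E" "y = G x" by blast
    define u where "u = x - cinner e x *\<^sub>C e"
    have "u \<in> orthocomp (insert e E)"
      using x(1) e by (simp add: orthocomp_def u_def cinner.diff_right cinner_scaleC_right cinner_same)
    moreover have "y = G u + cinner e x *\<^sub>C G e"
      unfolding x(2) bounded_clinear_scaleC[OF G, symmetric] bounded_clinear_add[OF G, symmetric]
      by (simp add: u_def)
    ultimately show "y \<in> ?S" by blast
  next
    fix y assume "y \<in> ?S"
    then obtain x t where x: "x \<in> orthocomp (insert e E)" "y = G x + t *\<^sub>C G e" by blast
    have "x + t *\<^sub>C e \<in> orthocomp E"
      using x(1) e(2) by (simp add: orthocomp_def cinner.add_right cinner_scaleC_right)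
    moreover have "y = G (x + t *\<^sub>C e)"
      by (simp add: x(2) bounded_clinear_add[OF G] bounded_clinear_scaleC[OF G])
    ultimately show "y \<in> G ` orthocomp E" by blast
  qed
  moreover have "closed ?S"
    by (intro closed_csubspace_add_line csubspace_image G csubspace_orthocomp insert.prems)
  ultimately have "closed (G ` orthocomp E)" by simp
  then show ?case
    by (rule insert.IH[OF E])
qed simp

text \<open>Off a finite orthonormal set \<open>R\<close> is at most half of \<open>c\<close> in
  norm, so \<open>R - c\<close> is bounded below there. This gives the finite-dimensional kernel and
  the closed range; finite codimension of the range comes from a fixed point.\<close>

lemma fredholm_finitely_small_shift:
  fixes R :: "'a::{complex_inner, complete_space} \<Rightarrow> 'a"
  assumes R: "bounded_clinear R" "finitely_small R" and c: "c \<noteq> 0"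
  shows "fredholm (\<lambda>x. R x - c *\<^sub>C x)" (is "fredholm ?G")
proof -
  note lin = bounded_clinear_bounded_linear[OF R(1)]
  have G: "bounded_clinear ?G"
    by (rule bounded_clinear_shift[OF R(1)])
  have "cmod c / 2 > 0" using c by simp
  then obtain E where E: "finite E" "orthonormal E"
    "\<And>x. x \<in> orthocomp E \<Longrightarrow> norm (R x) \<le> cmod c / 2 * norm x"
    using finitely_small_orthonormalE[OF R(2)] by metis
  have lower: "cmod c / 2 * norm x \<le> norm (?G x)" if "x \<in> orthocomp E" for x
    using E(3)[OF that] norm_triangle_ineq2[of "c *\<^sub>C x" "R x"]
    by (simp add: norm_scaleC norm_minus_commute)
  have "finite_dim_set {x. ?G x = 0}"
  proof (rule finite_dim_of_Int_orthocomp[OF E(1)])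
    show "csubspace {x. ?G x = 0}"
      by (rule csubspace_kernel[OF G])
    show "{x. ?G x = 0} \<inter> orthocomp E \<subseteq> {0}"
    proof
      fix x assume "x \<in> {x. ?G x = 0} \<inter> orthocomp E"
      then have "cmod c / 2 * norm x \<le> 0"
        using lower[of x] by simp
      with c show "x \<in> {0}" by (simp add: mult_le_0_iff)
    qed
  qed
  moreover have "closed (range ?G)"
  proof (rule closed_range_if_closed_orthocomp_image[OF G E(1,2)])
    have "complete (?G ` orthocomp E)"
    proof (rule complete_isometric_image[OF \<open>cmod c / 2 > 0\<close> _ bounded_clinear_bounded_linear[OF G]])
      show "subspace (orthocomp E)"
        by (intro subspaceI csubspace_zero csubspace_add csubspace_scaleR csubspace_orthocomp)
      show "complete (orthocomp E)"
        by (simp add: complete_eq_closed closed_orthocomp)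
    qed (use lower in blast)
    then show "closed (?G ` orthocomp E)"
      by (simp add: complete_eq_closed)
  qed
  moreover have "\<exists>x. y - ?G x \<in> cspan (E \<union> R ` E)" for y
  proof -
    \<comment> \<open>With \<open>Q\<close> the projection onto \<open>orthocomp E\<close>, \<open>Q R Q - c\<close> is invertible by a contraction
      argument, and it differs from \<open>R - c\<close> by an operator of finite rank.\<close>
    define Q where "Q x = x - proj E x" for x
    have Q: "bounded_linear Q"
      unfolding Q_def [abs_def]
      by (intro bounded_linear_sub bounded_linear_ident bounded_clinear_bounded_linear bounded_clinear_proj)
    \<comment> \<open>A fixed point of \<open>f\<close> solves
      \<open>Q (R (Q x)) - c *\<^sub>C x = y\<close>.\<close>
    define f where "f x = inverse c *\<^sub>C (Q (R (Q x)) - y)" for x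
    have "dist (f u) (f v) \<le> 1 / 2 * dist u v" for u v
    proof -
      have "f u - f v = inverse c *\<^sub>C Q (R (Q (u - v)))"
        by (simp add: f_def linear_diff bounded_linear.linear[OF Q] bounded_linear.linear[OF lin]
            flip: scaleC.diff_right)
      moreover have "norm (Q (R (Q (u - v)))) \<le> norm (R (Q (u - v)))"
        unfolding Q_def by (intro norm_diff_proj_le E)
      moreover have "norm (R (Q (u - v))) \<le> cmod c / 2 * norm (Q (u - v))"
        unfolding Q_def by (intro E(3) diff_proj_orthocomp E)
      moreover have "norm (Q (u - v)) \<le> norm (u - v)"
        unfolding Q_def by (intro norm_diff_proj_le E)
      then have "cmod c / 2 * norm (Q (u - v)) \<le> cmod c / 2 * norm (u - v)"
        by (rule mult_left_mono) simp
      ultimately have "norm (Q (R (Q (u - v)))) \<le> cmod c / 2 * norm (u - v)"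
        and eq: "f u - f v = inverse c *\<^sub>C Q (R (Q (u - v)))"
        by linarith+
      then have "inverse (cmod c) * norm (Q (R (Q (u - v)))) \<le> inverse (cmod c) * (cmod c / 2 * norm (u - v))"
        by (intro mult_left_mono) simp_all
      also have "\<dots> = 1 / 2 * norm (u - v)"
        using c by simp
      finally show ?thesis
        by (simp add: dist_norm eq norm_scaleC norm_inverse)
    qed
    then obtain x where "f x = x"
      using banach_fix_type[of "1 / 2" f] by auto
    then have "c *\<^sub>C f x = c *\<^sub>C x" by simp
    then have y: "y = Q (R (Q x)) - c *\<^sub>C x"
      using c by (simp add: f_def scaleC_scaleC scaleC_one algebra_simps)
    have "R x = R (Q x) + R (proj E x)"
      by (simp add: Q_def flip: bounded_clinear_add[OF R(1)])
    \<comment> \<open>The error of the approximate solution consists of finite-rank terms with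
      values in the span of \<open>E\<close> and of its image under \<open>R\<close>.\<close>
    then have "y - ?G x = - 1 *\<^sub>R proj E (R (Q x)) - R (proj E x)"
      unfolding y by (simp add: Q_def[of "R (Q x)"])
    moreover have "proj E (R (Q x)) \<in> cspan (E \<union> R ` E)"
      using proj_in_cspan[OF E(1)] cspan_mono[of E "E \<union> R ` E"] by blast
    moreover have "R (proj E x) \<in> cspan (E \<union> R ` E)"
      unfolding proj_def bounded_clinear_sum_scaleC[OF R(1)]
      using cspan_superset[of "E \<union> R ` E"]
      by (intro csubspace_sum csubspace_scaleC csubspace_cspan) auto
    ultimately have "y - ?G x \<in> cspan (E \<union> R ` E)"
      by (simp only: csubspace_diff csubspace_scaleR csubspace_cspan)
    then show ?thesis by blast
  qed
  ultimately show ?thesis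
    unfolding fredholm_def using G E(1) by (meson finite_UnI finite_imageI)
qed

text \<open>In infinite dimension some unit vector \<open>u\<close> is orthogonal to all differences
  between the centre \<open>x\<close> and the finitely many net points. Moving from \<open>x\<close>
  by \<open>r / 2\<close> along \<open>u\<close> leaves every net ball without leaving
  \<open>C\<close>.\<close>

lemma finite_dim_if_compact_interior:
  fixes C :: "'a::complex_inner set"
  assumes "compact C" "interior C \<noteq> {}"
  shows "finite_dim_set (UNIV :: 'a set)"
proof (rule ccontr)
  assume inf: "\<not> finite_dim_set (UNIV :: 'a set)"
  obtain x r where r: "r > 0" "ball x r \<subseteq> C"
    using assms(2) mem_interior by blast
  then obtain k where k: "finite k" "C \<subseteq> (\<Union>b\<in>k. ball b (r / 2))"
    using assms(1) unfolding compact_eq_totally_bounded by (meson half_gt_zero)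
  obtain u where u: "norm u = 1" "u \<in> orthocomp ((\<lambda>b. x - b) ` k)"
    using ex_unit_orthocomp[OF inf finite_imageI[OF k(1)]] by metis
  have "x + (r / 2) *\<^sub>R u \<in> ball x r"
    using r(1) u(1) by (simp add: dist_norm)
  then obtain b where b: "b \<in> k" "dist b (x + (r / 2) *\<^sub>R u) < r / 2"
    using r(2) k(2) by fastforce
  have "(norm ((x - b) + (r / 2) *\<^sub>R u))\<^sup>2 = (norm (x - b))\<^sup>2 + (norm ((r / 2) *\<^sub>R u))\<^sup>2"
    using u(2) b(1) by (intro norm_add_sq_orthogonal) (simp add: orthocomp_def cinner.scaleR_right)
  then have "(r / 2)\<^sup>2 \<le> (norm ((x - b) + (r / 2) *\<^sub>R u))\<^sup>2"
    using u(1) r(1) by (simp add: power_mult_distrib)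
  then have "r / 2 \<le> norm ((x - b) + (r / 2) *\<^sub>R u)"
    by (rule power2_le_imp_le) simp
  also have "\<dots> = dist b (x + (r / 2) *\<^sub>R u)"
    by (simp add: dist_norm norm_minus_commute algebra_simps)
  finally show False using b(2) by simp
qed

text \<open>A Fredholm compact operator would exhibit the space as a countable union of compact sets,
  against Baire's theorem.\<close>

lemma not_fredholm_finitely_small:
  fixes R :: "'a::{complex_inner, complete_space} \<Rightarrow> 'a"
  assumes R: "bounded_clinear R" "finitely_small R"
    and inf: "\<not> finite_dim_set (UNIV :: 'a set)"
  shows "\<not> fredholm R"
proof
  assume "fredholm R"
  then obtain B where B: "finite B" "\<And>y. \<exists>x. y - R x \<in> cspan B"
    unfolding fredholm_def by blast
  obtain E where E: "finite E" "orthonormal E" "cspan E = cspan B"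
    using ex_orthonormal_basis[OF B(1)] .
  \<comment> \<open>\<open>D n\<close> takes care of images of vectors of norm at most
    \<open>n\<close>, and \<open>S n\<close> of the finite-dimensional complement of the range;
    their sums \<open>C n\<close> are compact and will exhaust the space.\<close>
  define S where "S n = {\<Sum>e\<in>E. t e *\<^sub>C e | t. \<forall>e\<in>E. cmod (t e) \<le> real n}" for n
  define D where "D n = (\<lambda>u. real n *\<^sub>R u) ` closure (R ` cball 0 1)" for n
  define C where "C n = {u + v | u v. u \<in> D n \<and> v \<in> S n}" for n
  have "compact (C n)" for n
  proof -
    have "compact (D n)"
      unfolding D_def
      by (intro compact_continuous_image continuous_intros compact_closure_finitely_small R)
    moreover have "compact (S n)"
      unfolding S_def by (rule compact_combinations[OF E(1)])
    ultimately show ?thesis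
      unfolding C_def by (rule compact_sums)
  qed
  then have "interior (C n) = {}" for n
    using finite_dim_if_compact_interior inf by blast
  then have "euclidean interior_of \<Union> (range C) = {}"
    using \<open>\<And>n. compact (C n)\<close>
    by (intro Baire_category_alt disjI1 completely_metrizable_space_euclidean) (auto intro: compact_imp_closed)
  moreover have "\<Union> (range C) = UNIV"
  proof -
    have "y \<in> \<Union> (range C)" for y
    proof -
      obtain x where x: "y - R x \<in> cspan E"
        using B(2) E(3) by auto
      define w where "w = y - R x"
      \<comment> \<open>The summand 1 keeps \<open>n\<close> positive, so that \<open>x\<close> can
        be divided by it.\<close>
      obtain n where n: "norm x + norm w + 1 \<le> real n"
        using real_arch_simple by blast
      have "cmod (cinner e w) \<le> real n" if "e \<in> E" for e
      proof -
        have "cmod (cinner e w) \<le> norm w"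
          using norm_cinner_le[of e w] that E(2) by (simp add: orthonormal_def)
        then show ?thesis
          using n norm_ge_zero[of x] by linarith
      qed
      then have "proj E w \<in> S n"
        unfolding S_def proj_def by (intro CollectI exI[of _ "\<lambda>e. cinner e w"]) simp
      then have wS: "w \<in> S n"
        using proj_eq_self[OF E(1,2)] x by (simp add: w_def)
      have "real n > 0" using n norm_ge_zero[of x] norm_ge_zero[of w] by linarith
      have "norm x \<le> real n"
        using n norm_ge_zero[of w] by linarith
      then have "norm (inverse (real n) *\<^sub>R x) \<le> 1"
        using \<open>real n > 0\<close> by (simp add: field_simps)
      then have "R (inverse (real n) *\<^sub>R x) \<in> closure (R ` cball 0 1)"
        using closure_subset by (fastforce intro: imageI)
      moreover have "R x = real n *\<^sub>R R (inverse (real n) *\<^sub>R x)"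
        using \<open>real n > 0\<close>
        by (simp add: linear_scale[OF bounded_linear.linear[OF bounded_clinear_bounded_linear[OF R(1)]]])
      ultimately have "R x \<in> D n"
        unfolding D_def by blast
      with wS have "R x + w \<in> C n"
        unfolding C_def by blast
      then show ?thesis
        by (auto simp: w_def)
    qed
    then show ?thesis by blast
  qed
  ultimately show False by simp
qed

text \<open>\<open>A - l\<close> is the compact \<open>A - a\<close> shifted by
  \<open>l - a\<close>: Fredholm for a nonzero shift, and not Fredholm for \<open>l = a\<close>
  because the dimension is infinite.\<close>

lemma ess_spectrum_of_finitely_small:
  fixes A :: "'a::{complex_inner, complete_space} \<Rightarrow> 'a"
  assumes A: "bounded_clinear A" and small: "finitely_small (\<lambda>x. A x - a *\<^sub>C x)"
    and inf: "\<not> finite_dim_set (UNIV :: 'a set)"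
  shows "ess_spectrum A = {a}"
proof -
  note R = bounded_clinear_shift[OF A, of a]
  have "fredholm (\<lambda>x. A x - l *\<^sub>C x)" if "l \<noteq> a" for l
  proof -
    have "(\<lambda>x. A x - l *\<^sub>C x) = (\<lambda>x. (A x - a *\<^sub>C x) - (l - a) *\<^sub>C x)"
      by (simp add: scaleC.diff_left)
    with fredholm_finitely_small_shift[OF R small, of "l - a"] that show ?thesis by simp
  qed
  with not_fredholm_finitely_small[OF R small inf] show ?thesis
    unfolding ess_spectrum_def by auto
qed

section \<open>Block operators\<close>

text \<open>The second coordinates of a finite spanning set of the product would span the second
  factor.\<close>

lemma infinite_dim_prod:
  assumes "\<not> finite_dim_set (UNIV :: 'b::complex_inner set)"
  shows "\<not> finite_dim_set (UNIV :: ('a::complex_inner \<times> 'b) set)"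
proof
  assume "finite_dim_set (UNIV :: ('a \<times> 'b) set)"
  then obtain B :: "('a \<times> 'b) set" where B: "finite B" "UNIV \<subseteq> cspan B"
    unfolding finite_dim_set_def by blast
  have "csubspace {p :: 'a \<times> 'b. snd p \<in> cspan (snd ` B)}"
    using csubspace_cspan[of "snd ` B"] by (auto simp: csubspace_def scaleC_prod_def)
  then have "cspan B \<subseteq> {p. snd p \<in> cspan (snd ` B)}"
    using cspan_superset[of "snd ` B"] by (intro cspan_minimal) auto
  then have "snd p \<in> cspan (snd ` B)" for p :: "'a \<times> 'b"
    using B(2) by blast
  then have "y \<in> cspan (snd ` B)" for y
    using snd_conv by metis
  with assms B(1) show False
    unfolding finite_dim_set_def by blast
qed

lemma is_adjoint_snd: "is_adjoint snd (\<lambda>x. (0, x))"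
  and is_adjoint_fst: "is_adjoint fst (\<lambda>x. (x, 0))"
  by (simp_all add: is_adjoint_def cinner_prod_def cinner.zero_right)

text \<open>\<open>J\<close> is the embedding of a summand and \<open>J'\<close> its adjoint, so \<open>A\<close> is the diagonal entry of \<open>T\<close>.\<close>

lemma compression_AN_and_ess_spectrum:
  fixes A :: "'a::{complex_inner, complete_space} \<Rightarrow> 'a" and T :: "'c::complex_inner \<Rightarrow> 'c"
  assumes A: "positive_op A" and \<alpha>: "\<alpha> \<ge> 0"
    and inf: "\<not> finite_dim_set (UNIV :: 'a set)"
    and J: "is_adjoint J' J" "\<And>x. norm (J x) = norm x"
    and AT: "\<And>x. cinner x (A x) = cinner (J x) (T (J x))"
      "\<And>x. norm (A x - complex_of_real \<alpha> *\<^sub>C x) \<le> norm (T (J x) - complex_of_real \<alpha> *\<^sub>C J x)"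
    and T: "finitely_small (\<lambda>x. T x - complex_of_real \<alpha> *\<^sub>C x)"
      "finite E" "\<And>x. x \<in> orthocomp E \<Longrightarrow> \<alpha> * (norm x)\<^sup>2 \<le> Re (cinner x (T x))"
  shows "AN A" and "ess_spectrum A = {complex_of_real \<alpha>}"
proof -
  have small: "finitely_small (\<lambda>x. A x - complex_of_real \<alpha> *\<^sub>C x)"
    by (rule finitely_small_pullback[OF T(1) J(1), of 1]) (use J(2) AT(2) in simp_all)
  have "\<alpha> * (norm x)\<^sup>2 \<le> Re (cinner x (A x))" if "x \<in> orthocomp (J' ` E)" for x
  proof -
    have "J x \<in> orthocomp E"
      using that by (simp add: orthocomp_def is_adjointD[OF J(1)])
    from T(3)[OF this] show ?thesis
      by (simp add: AT(1) J(2))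
  qed
  then show "AN A"
    by (rule AN_of_finitely_small[OF A \<alpha> small finite_imageI[OF T(2)]])
  show "ess_spectrum A = {complex_of_real \<alpha>}"
    by (rule ess_spectrum_of_finitely_small[OF positive_op_bounded_clinear[OF A] small inf])
qed

theorem theorem3p11:
  fixes A1 :: "'a::{complex_inner, complete_space} \<Rightarrow> 'a"
    and A2 :: "'b::{complex_inner, complete_space} \<Rightarrow> 'b"
    and X :: "'b \<Rightarrow> 'a"
    and Xs :: "'a \<Rightarrow> 'b"
  assumes "separable_infdim TYPE('a)" and "separable_infdim TYPE('b)"
    and "positive_op A1" and "positive_op A2"
    and "bounded_clinear X" and "is_adjoint X Xs"
    and "positive_op (block_op A1 X Xs A2)"
    and "AN (block_op A1 X Xs A2)"
  shows "AN A1 \<and> AN A2 \<and> ess_spectrum A1 = ess_spectrum A2 \<and> compact_op X"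
proof -
  let ?T = "block_op A1 X Xs A2"
  have inf: "\<not> finite_dim_set (UNIV :: 'a set)" "\<not> finite_dim_set (UNIV :: 'b set)"
    using assms(1,2) by (simp_all add: separable_infdim_def)
  have zero: "f 0 = 0" if "bounded_clinear f" for f :: "'c::complex_inner \<Rightarrow> 'd::complex_inner"
    by (rule linear_0[OF bounded_linear.linear[OF bounded_clinear_bounded_linear[OF that]]])
  have z: "A1 0 = 0" "A2 0 = 0" "X 0 = 0" "Xs 0 = 0"
  proof -
    show 0: "A1 0 = 0" "A2 0 = 0" "X 0 = 0"
      by (rule zero[OF positive_op_bounded_clinear[OF assms(3)]]
          zero[OF positive_op_bounded_clinear[OF assms(4)]] zero[OF assms(5)])+
    \<comment> \<open>The value of \<open>Xs\<close> at 0 is read off from the linear block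
      operator.\<close>
    have "?T 0 = 0"
      by (rule zero[OF positive_op_bounded_clinear[OF assms(7)]])
    with 0 show "Xs 0 = 0"
      by (simp add: block_op_def zero_prod_def)
  qed
  obtain \<alpha> B where \<alpha>: "\<alpha> \<ge> 0"
    and small: "finitely_small (\<lambda>x. ?T x - complex_of_real \<alpha> *\<^sub>C x)"
    and B: "finite B" "\<And>x. x \<in> orthocomp B \<Longrightarrow> \<alpha>\<^sup>2 * (norm x)\<^sup>2 \<le> (norm (?T x))\<^sup>2"
    using positive_AN_finitely_small[OF assms(8,7) infinite_dim_prod[OF inf(2)]] by blast
  obtain E where E: "finite E"
    "\<And>x. x \<in> orthocomp E \<Longrightarrow> \<alpha> * (norm x)\<^sup>2 \<le> Re (cinner x (?T x))"
    using finitely_many_negative_directions[OF assms(7) small B] by blast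
  \<comment> \<open>These are the columns of \<open>?T - \<alpha>\<close>: the norm of a column
    dominates each of its entries, among them the shifted diagonal entry.\<close>
  have J1: "cinner x (A1 x) = cinner (x, 0) (?T (x, 0))"
    "?T (x, 0) - complex_of_real \<alpha> *\<^sub>C (x, 0) = (A1 x - complex_of_real \<alpha> *\<^sub>C x, Xs x)" for x
    by (simp_all add: block_op_def cinner_prod_def scaleC_prod_def z cinner.zero_left scaleC.zero_right)
  have J2: "cinner x (A2 x) = cinner (0, x) (?T (0, x))"
    "?T (0, x) - complex_of_real \<alpha> *\<^sub>C (0, x) = (X x, A2 x - complex_of_real \<alpha> *\<^sub>C x)" for x
    by (simp_all add: block_op_def cinner_prod_def scaleC_prod_def z cinner.zero_left scaleC.zero_right)
  have "AN A1" "ess_spectrum A1 = {complex_of_real \<alpha>}"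
    by (rule compression_AN_and_ess_spectrum[OF assms(3) \<alpha> inf(1) is_adjoint_fst _ J1(1) _ small E];
        simp add: J1(2) norm_fst_le)+
  moreover have "AN A2" "ess_spectrum A2 = {complex_of_real \<alpha>}"
    by (rule compression_AN_and_ess_spectrum[OF assms(4) \<alpha> inf(2) is_adjoint_snd _ J2(1) _ small E];
        simp add: J2(2) norm_snd_le)+
  \<comment> \<open>\<open>X\<close> is the upper entry of the second column, which \<alpha> does
    not affect.\<close>
  moreover have "finitely_small X"
    by (rule finitely_small_pullback[OF small is_adjoint_snd, of 1]) (simp_all add: J2(2) norm_fst_le)
  then have "compact_op X"
    using assms(5) by (simp add: compact_op_def compact_closure_finitely_small)
  ultimately show ?thesis by simp
qed

end
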